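(* Let $R=k[x_1,\dots,x_n]$. Let $I=(F_1,\dots,F_r)$ be an ideal of $r\ge n$ general forms in $R$, with minimal graded free resolution \[ 0\to\mathbb F_n\to\dots\to\mathbb F_2\to\mathbb F_1\to I\to 0 . \] Assume that the Maximal Rank property holds for all ideals of fewer than $r$ general forms in $R$. Then the only ghost terms that arise between $\mathbb F_2$ and $\mathbb F_1$ come from Koszul relations.
   Context: $k$ is an infinite field and $R$ is standard graded. "General forms" of prescribed degrees means: the statement holds for all tuples of forms in a nonempty Zariski open subset of the product of the corresponding spaces of forms. Maximal Rank property: a standard graded quotient $A=R/\mathfrak a$ (or the ideal $\mathfrak a$) has it if for every $e\ge 1$ and a general form $F\in R_e$, the multiplication map $\times F:A_i\to A_{i+e}$ has maximal rank (is injective or surjective) for every $i$. The assumption means that for all $s<r$ and all degrees, the ideal generated by $s$ general forms of these degrees has the Maximal Rank property. A ghost term between $\mathbb F_2$ and $\mathbb F_1$ is an $R(-t)$ occurring as a direct summand of both $\mathbb F_1$ and $\mathbb F_2$. Let $K_\bullet$ be the Koszul complex on $F_1,\dots,F_r$ (so $K_2=\bigoplus_{i<j}R(-\deg F_i-\deg F_j)$). A comparison map from $K_\bullet$ to the minimal resolution $\dots\to\mathbb F_2\to\mathbb F_1\to R$ of $R/I$ induces a well-defined map $(K_2\otimes_R k)_t\to(\mathbb F_2\otimes_R k)_t=\mathrm{Tor}_2^R(R/I,k)_t$. A ghost term $R(-t)$ between $\mathbb F_2$ and $\mathbb F_1$ comes from Koszul relations if this map is surjective in degree $t$, i.e. all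 minimal first syzygies of degree $t$ may be taken to be Koszul relations $F_i\cdot F_j-F_j\cdot F_i=0$. *)

theory Defs
  imports
    "HOL-Library.Poly_Mapping"
    "HOL-Library.FuncSet"
    "HOL-Library.Cardinality"
    "HOL-Library.Set_Algebras"
    "Jordan_Normal_Form.Matrix_Kernel"
begin

section \<open>Polynomials and forms\<close>

text \<open>
  Polynomials over \<open>'k\<close> in variables indexed by \<open>'x\<close>. For a finite type \<open>'v\<close> with
  \<open>CARD('v) = n\<close>, the type \<open>('v, 'k) mpoly\<close> is the standard graded ring
  \<open>R = k[x\<^sub>1, \<dots>, x\<^sub>n]\<close>; its maximal homogeneous ideal consists of the polynomials whose
  constant coefficient \<open>lookup p 0\<close> vanishes.
\<close>

type_synonym ('x, 'k) mpoly = "('x \<Rightarrow>\<^sub>0 nat) \<Rightarrow>\<^sub>0 'k"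

definition mdeg :: "('v::finite \<Rightarrow>\<^sub>0 nat) \<Rightarrow> nat" where
  "mdeg m = (\<Sum>v\<in>UNIV. Poly_Mapping.lookup m v)"

definition forms :: "nat \<Rightarrow> ('v::finite, 'k::field) mpoly set" where
  "forms e = {p. \<forall>m\<in>Poly_Mapping.keys p. mdeg m = e}"

definition mpoly_eval :: "('x, 'k::field) mpoly \<Rightarrow> ('x \<Rightarrow> 'k) \<Rightarrow> 'k" where
  "mpoly_eval p a =
     (\<Sum>m\<in>Poly_Mapping.keys p.
        Poly_Mapping.lookup p m * (\<Prod>x\<in>Poly_Mapping.keys m. a x ^ Poly_Mapping.lookup m x))"

section \<open>General forms\<close>

definition form_tuples :: "nat \<Rightarrow> (nat \<Rightarrow> nat) \<Rightarrow> (nat \<Rightarrow> ('v::finite, 'k::field) mpoly) set" where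
  "form_tuples r d = (\<Pi>\<^sub>E i\<in>{..<r}. forms (d i))"

text \<open>
  Zariski closed subsets of the affine space \<open>R\<^bsub>d 0\<^esub> \<times> \<dots> \<times> R\<^bsub>d (r - 1)\<^esub>\<close> are the common
  zero sets of polynomials in the coefficients of the forms; the coordinate \<open>(i, m)\<close> is the
  coefficient of the monomial \<open>m\<close> in the \<open>i\<close>-th form. All coordinates outside the finitely many
  relevant ones are constant on \<open>form_tuples r d\<close>.
\<close>

definition zariski_closed ::
  "nat \<Rightarrow> (nat \<Rightarrow> nat) \<Rightarrow> (nat \<Rightarrow> ('v::finite, 'k::field) mpoly) set \<Rightarrow> bool" where
  "zariski_closed r d Z \<longleftrightarrow>
    (\<exists>S :: (nat \<times> ('v \<Rightarrow>\<^sub>0 nat), 'k) mpoly set.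
       Z = {F \<in> form_tuples r d. \<forall>p\<in>S. mpoly_eval p (\<lambda>(i, m). Poly_Mapping.lookup (F i) m) = 0})"

definition zariski_open ::
  "nat \<Rightarrow> (nat \<Rightarrow> nat) \<Rightarrow> (nat \<Rightarrow> ('v::finite, 'k::field) mpoly) set \<Rightarrow> bool" where
  "zariski_open r d U \<longleftrightarrow> U \<subseteq> form_tuples r d \<and> zariski_closed r d (form_tuples r d - U)"

definition for_general_forms ::
  "nat \<Rightarrow> (nat \<Rightarrow> nat) \<Rightarrow> ((nat \<Rightarrow> ('v::finite, 'k::field) mpoly) \<Rightarrow> bool) \<Rightarrow> bool" where
  "for_general_forms r d P \<longleftrightarrow> (\<exists>U. zariski_open r d U \<and> U \<noteq> {} \<and> (\<forall>F\<in>U. P F))"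

section \<open>The Maximal Rank property\<close>

definition ideal_of :: "nat \<Rightarrow> (nat \<Rightarrow> ('v::finite, 'k::field) mpoly) \<Rightarrow> ('v, 'k) mpoly set" where
  "ideal_of r F = {(\<Sum>i<r. g i * F i) | g. True}"

text \<open>
  For a homogeneous ideal \<open>\<aa>\<close>, the graded piece \<open>A\<^sub>e\<close> of \<open>A = R/\<aa>\<close> is the set of cosets
  \<open>f + \<aa>\<close> with \<open>f \<in> R\<^sub>e\<close>. Multiplication by \<open>F\<close> sends \<open>C = f + \<aa>\<close> to
  \<open>F \<cdot> C + \<aa> = F \<cdot> f + \<aa>\<close> (sums and products of sets are taken elementwise).
\<close>

definition quot_piece :: "('v::finite, 'k::field) mpoly set \<Rightarrow> nat \<Rightarrow> ('v, 'k) mpoly set set" where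
  "quot_piece \<aa> e = (\<lambda>f. f +o \<aa>) ` forms e"

definition quot_mult ::
  "('v::finite, 'k::field) mpoly set \<Rightarrow> ('v, 'k) mpoly \<Rightarrow> ('v, 'k) mpoly set \<Rightarrow> ('v, 'k) mpoly set"
where
  "quot_mult \<aa> F C = (F *o C) + \<aa>"

definition maximal_rank_property :: "('v::finite, 'k::field) mpoly set \<Rightarrow> bool" where
  "maximal_rank_property \<aa> \<longleftrightarrow>
    (\<forall>e\<ge>1. for_general_forms 1 (\<lambda>_. e) (\<lambda>F. \<forall>i.
       inj_on (quot_mult \<aa> (F 0)) (quot_piece \<aa> i) \<or>
       quot_mult \<aa> (F 0) ` quot_piece \<aa> i = quot_piece \<aa> (i + e)))"

section \<open>Minimal graded free resolutions\<close>

text \<open>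
  A graded free module \<open>\<Oplus>\<^sub>j R(-a\<^sub>j)\<close> of finite rank is given by the list \<open>as\<close> of its shifts;
  its elements are the vectors in \<open>carrier_vec (length as)\<close>, the \<open>j\<close>-th basis vector having
  degree \<open>as ! j\<close>.
\<close>

definition free_piece :: "int list \<Rightarrow> int \<Rightarrow> ('v::finite, 'k::field) mpoly vec set" where
  "free_piece as t = {v \<in> carrier_vec (length as).
     \<forall>j<length as. \<forall>m\<in>Poly_Mapping.keys (v $ j). int (mdeg m) + as ! j = t}"

text \<open>
  \<open>sh i\<close> are the shifts of \<open>\<bbbF>\<^sub>i\<close>, with \<open>\<bbbF>\<^sub>0 = R\<close>, and \<open>\<phi> i\<close> is the matrix of the graded
  (degree \<open>0\<close>) homomorphism \<open>\<bbbF>\<^sub>i \<rightarrow> \<bbbF>\<^sub>i\<^sub>-\<^sub>1\<close>, its columns being the images of the basis vectors.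
  The image of \<open>\<phi> 1 : \<bbbF>\<^sub>1 \<rightarrow> R\<close> is \<open>I\<close>.
  Minimality means that all entries of the matrices lie in the maximal homogeneous ideal.
\<close>

definition minimal_graded_free_resolution ::
  "('v::finite, 'k::field) mpoly set \<Rightarrow> (nat \<Rightarrow> int list) \<Rightarrow> (nat \<Rightarrow> ('v, 'k) mpoly mat) \<Rightarrow> bool"
where
  "minimal_graded_free_resolution I sh \<phi> \<longleftrightarrow>
     sh 0 = [0] \<and>
     (\<forall>i>CARD('v). sh i = []) \<and>
     (\<forall>i\<ge>1. \<phi> i \<in> carrier_mat (length (sh (i - 1))) (length (sh i)) \<and>
        (\<forall>q<length (sh i). col (\<phi> i) q \<in> free_piece (sh (i - 1)) (sh i ! q)) \<and>
        (\<forall>p<length (sh (i - 1)). \<forall>q<length (sh i). Poly_Mapping.lookup (\<phi> i $$ (p, q)) 0 = 0)) \<and>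
     {(\<phi> 1 *\<^sub>v v) $ 0 | v. v \<in> carrier_vec (length (sh 1))} = I \<and>
     (\<forall>i\<ge>1. mat_kernel (\<phi> i) = {\<phi> (i + 1) *\<^sub>v v | v. v \<in> carrier_vec (length (sh (i + 1)))})"

definition ghost_term :: "(nat \<Rightarrow> int list) \<Rightarrow> int \<Rightarrow> bool" where
  "ghost_term sh t \<longleftrightarrow> t \<in> set (sh 1) \<and> t \<in> set (sh 2)"

section \<open>Koszul relations\<close>

text \<open>
  The Koszul complex on \<open>F 0, \<dots>, F (r - 1)\<close> has as basis of \<open>K\<^sub>p\<close> the elements \<open>e\<^sub>S\<close>, where
  \<open>S \<subseteq> {..<r}\<close> and \<open>card S = p\<close>, of degree \<open>\<Sum>i\<in>S. d i\<close>, with differential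
  \<open>e\<^sub>S \<mapsto> \<Sum>i\<in>S. (-1) ^ #{j \<in> S. j < i} \<cdot> F i \<cdot> e\<^bsub>S - {i}\<^esub>\<close>.
  A graded chain map \<open>K\<^sub>\<bullet> \<rightarrow> \<bbbF>\<^sub>\<bullet>\<close> is determined by the images \<open>\<kappa> S\<close> of the \<open>e\<^sub>S\<close>; it is a
  comparison map if it is the identity on \<open>K\<^sub>0 = R = \<bbbF>\<^sub>0\<close>.
\<close>

definition koszul_comparison ::
  "nat \<Rightarrow> (nat \<Rightarrow> nat) \<Rightarrow> (nat \<Rightarrow> ('v::finite, 'k::field) mpoly) \<Rightarrow>
   (nat \<Rightarrow> int list) \<Rightarrow> (nat \<Rightarrow> ('v, 'k) mpoly mat) \<Rightarrow> (nat set \<Rightarrow> ('v, 'k) mpoly vec) \<Rightarrow> bool"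
where
  "koszul_comparison r d F sh \<phi> \<kappa> \<longleftrightarrow>
     \<kappa> {} = vec 1 (\<lambda>_. 1) \<and>
     (\<forall>S\<subseteq>{..<r}. \<kappa> S \<in> free_piece (sh (card S)) (int (\<Sum>i\<in>S. d i))) \<and>
     (\<forall>S\<subseteq>{..<r}. S \<noteq> {} \<longrightarrow>
        \<phi> (card S) *\<^sub>v \<kappa> S =
        vec (length (sh (card S - 1)))
          (\<lambda>q. \<Sum>i\<in>S. (-1) ^ card {j\<in>S. j < i} * F i * (\<kappa> (S - {i}) $ q)))"

text \<open>
  For a graded free module with shifts \<open>as\<close>, the tensor product with \<open>k = R/(x\<^sub>1, \<dots>, x\<^sub>n)\<close> is
  \<open>k\<^bsup>length as\<^esup>\<close>, via the constant coefficients, with the \<open>j\<close>-th basis vector in degree \<open>as ! j\<close>.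
\<close>

definition fibre_piece :: "int list \<Rightarrow> int \<Rightarrow> 'k::field vec set" where
  "fibre_piece as t = {w \<in> carrier_vec (length as). \<forall>j<length as. w $ j \<noteq> 0 \<longrightarrow> as ! j = t}"

text \<open>The degree \<open>t\<close> part of \<open>K\<^sub>2 \<otimes> k\<close>, as coefficient families on the basis \<open>e\<^sub>S\<close>.\<close>

definition koszul2_fibre_piece ::
  "nat \<Rightarrow> (nat \<Rightarrow> nat) \<Rightarrow> int \<Rightarrow> (nat set \<Rightarrow> 'k::field) set" where
  "koszul2_fibre_piece r d t =
     {c. \<forall>S. c S \<noteq> 0 \<longrightarrow> S \<subseteq> {..<r} \<and> card S = 2 \<and> int (\<Sum>i\<in>S. d i) = t}"

definition koszul2_fibre_map ::
  "nat \<Rightarrow> int list \<Rightarrow> (nat set \<Rightarrow> ('v::finite, 'k::field) mpoly vec) \<Rightarrow> (nat set \<Rightarrow> 'k) \<Rightarrow> 'k vec"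
where
  "koszul2_fibre_map r as \<kappa> c =
     vec (length as)
       (\<lambda>q. \<Sum>S | S \<subseteq> {..<r} \<and> card S = 2. c S * Poly_Mapping.lookup (\<kappa> S $ q) 0)"

text \<open>
  Comparison maps exist, and they all induce the same map \<open>(K\<^sub>2 \<otimes> k)\<^sub>t \<rightarrow> (\<bbbF>\<^sub>2 \<otimes> k)\<^sub>t\<close>. The
  existence clause keeps the definition from holding vacuously.
\<close>

definition comes_from_koszul ::
  "nat \<Rightarrow> (nat \<Rightarrow> nat) \<Rightarrow> (nat \<Rightarrow> ('v::finite, 'k::field) mpoly) \<Rightarrow>
   (nat \<Rightarrow> int list) \<Rightarrow> (nat \<Rightarrow> ('v, 'k) mpoly mat) \<Rightarrow> int \<Rightarrow> bool"
where
  "comes_from_koszul r d F sh \<phi> t \<longleftrightarrow>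
     (\<exists>\<kappa>. koszul_comparison r d F sh \<phi> \<kappa>) \<and>
     (\<forall>\<kappa>. koszul_comparison r d F sh \<phi> \<kappa> \<longrightarrow>
        koszul2_fibre_map r (sh 2) \<kappa> ` koszul2_fibre_piece r d t = fibre_piece (sh 2) t)"

end

theory Submission
  imports Defs "HOL-Computational_Algebra.Polynomial" "HOL-Library.Function_Algebras"
begin

text \<open>
  Let \<open>t\<close> be the degree of a ghost term and \<open>X\<close> the set of the \<open>i\<close> with \<open>d i < t\<close>. By
  minimality the coefficients of a minimal first syzygy lie in the maximal homogeneous ideal, so
  a syzygy of degree \<open>t\<close> involves only generators of degree less than \<open>t\<close>. Expressing these
  through the \<open>F i\<close> with \<open>i \<in> X\<close> turns it into a homogeneous relation \<open>\<Sum>i\<in>X. y i * F i = 0\<close> of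
  degree \<open>t\<close>. If the Koszul complex on the \<open>F i\<close>, \<open>i \<in> X\<close>, is exact at \<open>K\<^sub>1\<close> in degree \<open>t\<close>
  (\<open>koszul_exact\<close>), then \<open>y\<close> is a combination of Koszul relations, and carrying this combination
  over to \<open>\<bbbF>\<^sub>2\<close> recovers the given syzygy up to an element whose coefficients lie in the maximal
  ideal. This is \<open>koszul_fibre_map_onto\<close>.

  A minimal generator of degree \<open>t\<close> forces \<open>t = d i\<close> for some \<open>i\<close>, and forces the \<open>F i\<close> with
  \<open>i \<in> X\<close> not to generate all of \<open>R\<^sub>t\<close> (\<open>generator_degree\<close>). Hence only finitely many degrees
  matter, and for each of them it is enough that a general tuple of forms either generates \<open>R\<^sub>t\<close>
  by its members of degree less than \<open>t\<close> or has the exactness property.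

  Both alternatives are open conditions (\<open>spans_degree_open\<close>, \<open>koszul_exact_open\<close>), so a single
  tuple with one of these properties suffices. If no tuple generates \<open>R\<^sub>t\<close>, a tuple with the
  exactness property is built form by form (\<open>koszul_exact_general\<close>). Let \<open>\<aa>\<close> be the ideal
  of the forms chosen so far and \<open>F i\<close> the next one. Multiplication by a general \<open>F i\<close> from
  \<open>(R/\<aa>)\<^sub>j\<close>, \<open>j = t - d i\<close>, to \<open>(R/\<aa>)\<^sub>t\<close> has maximal rank. It is not surjective, since the forms
  would then generate \<open>R\<^sub>t\<close>; so it is injective. In a relation of degree \<open>t\<close> the coefficient of
  \<open>F i\<close> therefore lies in \<open>\<aa>\<close>, and subtracting Koszul relations leaves a relation among the
  earlier forms (\<open>koszul_exact_insert\<close>).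

  The set of admissible \<open>F i\<close> depends on the earlier forms, and nothing is known about how it varies
  with them. This is why the induction carries the exactness property and not the maximal
  rank of the successive multiplications: after each step one good tuple has been found, and openness
  of exactness turns it into a nonempty open set, which can be intersected with the open set on which
  the ideal of the next step has the Maximal Rank property.
\<close>

section \<open>Polynomial functions on tuples of forms\<close>

definition monomial_eval :: "('x \<Rightarrow>\<^sub>0 nat) \<Rightarrow> ('x \<Rightarrow> 'k::field) \<Rightarrow> 'k" where
  "monomial_eval m a = (\<Prod>x\<in>Poly_Mapping.keys m. a x ^ Poly_Mapping.lookup m x)"

lemma monomial_eval_superset:
  assumes "finite A" "Poly_Mapping.keys m \<subseteq> A"
  shows "monomial_eval m a = (\<Prod>x\<in>A. a x ^ Poly_Mapping.lookup m x)"
  unfolding monomial_eval_def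
  by (rule prod.mono_neutral_left) (use assms in \<open>auto simp: in_keys_iff\<close>)

lemma monomial_eval_add: "monomial_eval (m + m') a = monomial_eval m a * monomial_eval m' a"
proof -
  let ?A = "Poly_Mapping.keys m \<union> Poly_Mapping.keys m'"
  have "Poly_Mapping.keys (m + m') \<subseteq> ?A" by (rule keys_add)
  then show ?thesis
    by (simp add: monomial_eval_superset[of ?A] lookup_add power_add prod.distrib)
qed

lemma mpoly_eval_superset:
  assumes "finite A" "Poly_Mapping.keys p \<subseteq> A"
  shows "mpoly_eval p a = (\<Sum>m\<in>A. Poly_Mapping.lookup p m * monomial_eval m a)"
  unfolding mpoly_eval_def monomial_eval_def
  by (rule sum.mono_neutral_left) (use assms in \<open>auto simp: in_keys_iff\<close>)

lemma mpoly_eval_add: "mpoly_eval (p + q) a = mpoly_eval p a + mpoly_eval q a"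
proof -
  let ?A = "Poly_Mapping.keys p \<union> Poly_Mapping.keys q"
  have "Poly_Mapping.keys (p + q) \<subseteq> ?A" by (rule keys_add)
  then show ?thesis
    by (simp add: mpoly_eval_superset[of ?A] lookup_add algebra_simps sum.distrib)
qed

lemma mpoly_eval_single: "mpoly_eval (Poly_Mapping.single m c) a = c * monomial_eval m a"
  by (subst mpoly_eval_superset[of "{m}"]) auto

lemma mpoly_eval_zero: "mpoly_eval 0 a = 0"
  by (simp add: mpoly_eval_def)

lemma mpoly_eval_sum: "mpoly_eval (sum f A) a = (\<Sum>x\<in>A. mpoly_eval (f x) a)"
  by (induction A rule: infinite_finite_induct) (auto simp: mpoly_eval_add mpoly_eval_zero)

lemma sum_single_lookup:
  "(\<Sum>m\<in>Poly_Mapping.keys p. Poly_Mapping.single m (Poly_Mapping.lookup p m)) = p"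
proof (rule poly_mapping_eqI)
  fix k
  have "(\<Sum>m\<in>Poly_Mapping.keys p. Poly_Mapping.lookup p m when m = k)
      = (\<Sum>m\<in>Poly_Mapping.keys p. if m = k then Poly_Mapping.lookup p k else 0)"
    by (intro sum.cong) (auto simp: when_def)
  then show "Poly_Mapping.lookup
      (\<Sum>m\<in>Poly_Mapping.keys p. Poly_Mapping.single m (Poly_Mapping.lookup p m)) k
    = Poly_Mapping.lookup p k"
    by (simp add: lookup_sum lookup_single sum.delta' in_keys_iff)
qed

lemma mpoly_eval_mult: "mpoly_eval (p * q) a = mpoly_eval p a * mpoly_eval q a"
proof -
  let ?s = "\<lambda>p m. Poly_Mapping.single m (Poly_Mapping.lookup p m)"
  have "p * q = (\<Sum>m\<in>Poly_Mapping.keys p. \<Sum>m'\<in>Poly_Mapping.keys q. ?s p m * ?s q m')"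
    by (subst sum_product[symmetric]) (simp add: sum_single_lookup)
  then have "mpoly_eval (p * q) a = (\<Sum>m\<in>Poly_Mapping.keys p. \<Sum>m'\<in>Poly_Mapping.keys q.
      (Poly_Mapping.lookup p m * monomial_eval m a)
        * (Poly_Mapping.lookup q m' * monomial_eval m' a))"
    by (simp add: mpoly_eval_sum mult_single mpoly_eval_single monomial_eval_add mult_ac)
  also have "\<dots> = mpoly_eval p a * mpoly_eval q a"
    by (simp add: sum_product mpoly_eval_superset[OF _ order_refl])
  finally show ?thesis .
qed

text \<open>
  Agreement is required on \<open>form_tuples r d\<close> only, because Zariski closed sets do not see
  anything else. This leaves room for functions that are polynomial only under the constraint that
  the coefficients of \<open>F i\<close> outside degree \<open>d i\<close> vanish.
\<close>

definition polynomial_on ::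
  "nat \<Rightarrow> (nat \<Rightarrow> nat) \<Rightarrow> ((nat \<Rightarrow> ('v::finite, 'k::field) mpoly) \<Rightarrow> 'k) \<Rightarrow> bool" where
  "polynomial_on r d f \<longleftrightarrow>
     (\<exists>p. \<forall>F\<in>form_tuples r d. f F = mpoly_eval p (\<lambda>(i, m). Poly_Mapping.lookup (F i) m))"

lemma polynomial_on_cong:
  "polynomial_on r d f \<Longrightarrow> (\<And>F. F \<in> form_tuples r d \<Longrightarrow> f F = g F) \<Longrightarrow> polynomial_on r d g"
  unfolding polynomial_on_def by auto

lemma polynomial_on_const: "polynomial_on r d (\<lambda>F. c)"
  unfolding polynomial_on_def
  by (rule exI[of _ "Poly_Mapping.single 0 c"]) (simp add: mpoly_eval_single monomial_eval_def)

lemma polynomial_on_coeff: "polynomial_on r d (\<lambda>F. Poly_Mapping.lookup (F i) m)"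
  unfolding polynomial_on_def
  by (rule exI[of _ "Poly_Mapping.single (Poly_Mapping.single (i, m) 1) 1"])
     (simp add: mpoly_eval_single monomial_eval_def)

lemma polynomial_on_add:
  "polynomial_on r d f \<Longrightarrow> polynomial_on r d g \<Longrightarrow> polynomial_on r d (\<lambda>F. f F + g F)"
  unfolding polynomial_on_def by (metis mpoly_eval_add)

lemma polynomial_on_mult:
  "polynomial_on r d f \<Longrightarrow> polynomial_on r d g \<Longrightarrow> polynomial_on r d (\<lambda>F. f F * g F)"
  unfolding polynomial_on_def by (metis mpoly_eval_mult)

lemma polynomial_on_sum:
  "(\<And>x. x \<in> A \<Longrightarrow> polynomial_on r d (f x)) \<Longrightarrow> polynomial_on r d (\<lambda>F. \<Sum>x\<in>A. f x F)"
  by (induction A rule: infinite_finite_induct)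
     (auto intro: polynomial_on_const polynomial_on_add)

lemma polynomial_on_prod:
  "(\<And>x. x \<in> A \<Longrightarrow> polynomial_on r d (f x)) \<Longrightarrow> polynomial_on r d (\<lambda>F. \<Prod>x\<in>A. f x F)"
  by (induction A rule: infinite_finite_induct)
     (auto intro: polynomial_on_const polynomial_on_mult)

lemma polynomial_on_power: "polynomial_on r d f \<Longrightarrow> polynomial_on r d (\<lambda>F. f F ^ n)"
  by (induction n) (auto intro: polynomial_on_const polynomial_on_mult)

section \<open>Properties of general forms\<close>

text \<open>
  The principal open sets, on which one polynomial function does not vanish, form a basis of the
  Zariski topology. Genericity can thus be witnessed by one function and one point at which
  it is nonzero.
\<close>

lemma for_general_forms_iff:
  fixes P :: "(nat \<Rightarrow> ('v::finite, 'k::field) mpoly) \<Rightarrow> bool"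
  shows "for_general_forms r d P \<longleftrightarrow>
    (\<exists>f. polynomial_on r d f \<and> (\<exists>F\<in>form_tuples r d. f F \<noteq> 0) \<and>
         (\<forall>F\<in>form_tuples r d. f F \<noteq> 0 \<longrightarrow> P F))"
proof
  assume "for_general_forms r d P"
  then obtain U F0 where U: "U \<subseteq> form_tuples r d" "zariski_closed r d (form_tuples r d - U)"
    and F0: "F0 \<in> U" and P: "\<forall>F\<in>U. P F"
    unfolding for_general_forms_def zariski_open_def by blast
  from U(2) obtain S :: "(nat \<times> ('v \<Rightarrow>\<^sub>0 nat), 'k) mpoly set" where S: "form_tuples r d - U
      = {F \<in> form_tuples r d. \<forall>p\<in>S. mpoly_eval p (\<lambda>(i, m). Poly_Mapping.lookup (F i) m) = 0}"
    unfolding zariski_closed_def by blast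
  have "F0 \<notin> form_tuples r d - U" "F0 \<in> form_tuples r d" using F0 U(1) by auto
  then obtain p where p: "p \<in> S" "mpoly_eval p (\<lambda>(i, m). Poly_Mapping.lookup (F0 i) m) \<noteq> 0"
    using S by auto
  show "\<exists>f. polynomial_on r d f \<and> (\<exists>F\<in>form_tuples r d. f F \<noteq> 0) \<and>
         (\<forall>F\<in>form_tuples r d. f F \<noteq> 0 \<longrightarrow> P F)"
  proof (intro exI conjI ballI impI)
    let ?f = "\<lambda>F. mpoly_eval p (\<lambda>(i, m). Poly_Mapping.lookup (F i) m)"
    show "polynomial_on r d ?f" unfolding polynomial_on_def by auto
    show "\<exists>F\<in>form_tuples r d. ?f F \<noteq> 0" using p \<open>F0 \<in> form_tuples r d\<close> by auto
    fix F assume "F \<in> form_tuples r d" "?f F \<noteq> 0"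
    then have "F \<notin> form_tuples r d - U" using p(1) S by auto
    then show "P F" using P \<open>F \<in> form_tuples r d\<close> by auto
  qed
next
  assume "\<exists>f. polynomial_on r d f \<and> (\<exists>F\<in>form_tuples r d. f F \<noteq> 0) \<and>
         (\<forall>F\<in>form_tuples r d. f F \<noteq> 0 \<longrightarrow> P F)"
  then obtain f p F0 where p: "\<forall>F\<in>form_tuples r d.
        f F = mpoly_eval p (\<lambda>(i, m). Poly_Mapping.lookup (F i) m)"
    and F0: "F0 \<in> form_tuples r d" "f F0 \<noteq> 0" and P: "\<forall>F\<in>form_tuples r d. f F \<noteq> 0 \<longrightarrow> P F"
    unfolding polynomial_on_def by blast
  let ?U = "{F \<in> form_tuples r d. f F \<noteq> 0}"
  have "form_tuples r d - ?U = {F \<in> form_tuples r d.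
      \<forall>q\<in>{p}. mpoly_eval q (\<lambda>(i, m). Poly_Mapping.lookup (F i) m) = 0}"
    using p by auto
  then have "zariski_open r d ?U"
    unfolding zariski_open_def zariski_closed_def by blast
  then show "for_general_forms r d P"
    unfolding for_general_forms_def using F0 P by blast
qed

lemma for_general_formsI:
  assumes "polynomial_on r d f" "F0 \<in> form_tuples r d" "f F0 \<noteq> 0"
    "\<And>F. F \<in> form_tuples r d \<Longrightarrow> f F \<noteq> 0 \<Longrightarrow> P F"
  shows "for_general_forms r d P"
  using assms unfolding for_general_forms_iff by blast

lemma for_general_forms_mono:
  assumes "for_general_forms r d P" "\<And>F. F \<in> form_tuples r d \<Longrightarrow> P F \<Longrightarrow> Q F"
  shows "for_general_forms r d Q"
  using assms unfolding for_general_forms_iff by blast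

lemma for_general_forms_exists:
  "for_general_forms r d P \<Longrightarrow> \<exists>F\<in>form_tuples r d. P F"
  unfolding for_general_forms_iff by blast

lemma lookup_constant_mult:
  "Poly_Mapping.lookup (Poly_Mapping.single 0 c * p) m
    = c * Poly_Mapping.lookup (p :: ('x, 'k::field) mpoly) m"
  by (subst mult_map_scale_conv_mult[symmetric]) (simp add: Poly_Mapping.map.rep_eq when_def)

lemma forms_zero: "0 \<in> forms e"
  by (simp add: forms_def)

lemma form_tuples_nonempty: "\<exists>F. F \<in> (form_tuples r d :: (nat \<Rightarrow> ('v::finite, 'k::field) mpoly) set)"
  by (rule exI[of _ "\<lambda>i\<in>{..<r}. 0"]) (auto simp: form_tuples_def forms_zero)

lemma mpoly_eval_line:
  fixes L :: "'x \<Rightarrow> 'k::field poly"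
  shows "\<exists>P. \<forall>c. mpoly_eval p (\<lambda>x. poly (L x) c) = poly P c"
proof (intro exI allI)
  fix c
  show "mpoly_eval p (\<lambda>x. poly (L x) c) = poly (\<Sum>m\<in>Poly_Mapping.keys p.
      [:Poly_Mapping.lookup p m:] * (\<Prod>x\<in>Poly_Mapping.keys m. L x ^ Poly_Mapping.lookup m x)) c"
    by (simp add: mpoly_eval_def poly_sum poly_prod)
qed

text \<open>
  Irreducibility of the space of tuples. On the line through a point of one principal open set and a
  point of the other, both defining functions are nonzero polynomials in one variable; over an
  infinite field some point of the line avoids the roots of both.
\<close>

lemma for_general_forms_conj:
  fixes P Q :: "(nat \<Rightarrow> ('v::finite, 'k::field) mpoly) \<Rightarrow> bool"
  assumes inf: "infinite (UNIV :: 'k set)"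
    and P: "for_general_forms r d P" and Q: "for_general_forms r d Q"
  shows "for_general_forms r d (\<lambda>F. P F \<and> Q F)"
proof -
  obtain f F0 where f: "polynomial_on r d f" "F0 \<in> form_tuples r d" "f F0 \<noteq> 0"
    "\<And>F. F \<in> form_tuples r d \<Longrightarrow> f F \<noteq> 0 \<Longrightarrow> P F" using P unfolding for_general_forms_iff by blast
  obtain g G0 where g: "polynomial_on r d g" "G0 \<in> form_tuples r d" "g G0 \<noteq> 0"
    "\<And>F. F \<in> form_tuples r d \<Longrightarrow> g F \<noteq> 0 \<Longrightarrow> Q F" using Q unfolding for_general_forms_iff by blast
  define H where "H c = (\<lambda>i\<in>{..<r}. F0 i + Poly_Mapping.single 0 c * (G0 i - F0 i))" for c
  \<comment> \<open>Tuples take the value \<open>undefined\<close> outside \<open>{..<r}\<close>; there the coordinates are constant.\<close>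
  define L where "L = (\<lambda>(i, m). if i < r
    then [:Poly_Mapping.lookup (F0 i) m,
           Poly_Mapping.lookup (G0 i) m - Poly_Mapping.lookup (F0 i) m:]
    else [:Poly_Mapping.lookup (undefined :: ('v, 'k) mpoly) m:])"
  have L: "(\<lambda>(i, m). Poly_Mapping.lookup (H c i) m) = (\<lambda>x. poly (L x) c)" for c
    by (auto simp: H_def L_def lookup_add lookup_constant_mult lookup_minus fun_eq_iff)
  have H: "H c \<in> form_tuples r d" for c
  proof -
    have "mdeg m = d i" if "i < r" "Poly_Mapping.lookup (H c i) m \<noteq> 0" for i m
    proof -
      have "Poly_Mapping.lookup (F0 i) m \<noteq> 0 \<or> Poly_Mapping.lookup (G0 i) m \<noteq> 0"
        using that by (auto simp: H_def lookup_add lookup_constant_mult lookup_minus)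
      then show ?thesis
        using f(2) g(2) that(1) unfolding form_tuples_def by (auto simp: PiE_iff forms_def in_keys_iff)
    qed
    then show ?thesis
      by (auto simp: form_tuples_def PiE_iff forms_def in_keys_iff) (auto simp: H_def)
  qed
  have ends: "H 0 = F0" "H 1 = G0"
    using f(2) g(2) unfolding form_tuples_def H_def
    by (auto simp: PiE_iff fun_eq_iff restrict_def extensional_def)
  have "\<exists>A. \<forall>c. h (H c) = poly A c" if "polynomial_on r d h" for h
    using that H mpoly_eval_line[of _ L] unfolding polynomial_on_def L[symmetric] by metis
  then obtain A B where AB: "\<And>c. f (H c) = poly A c" "\<And>c. g (H c) = poly B c"
    using f(1) g(1) by metis
  have "A \<noteq> 0" "B \<noteq> 0" using AB(1)[of 0] AB(2)[of 1] f(3) g(3) ends by auto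
  then have "finite {c. poly (A * B) c = 0}" by (intro poly_roots_finite) auto
  then obtain c where "poly (A * B) c \<noteq> 0" using inf by (metis (mono_tags) UNIV_eq_I mem_Collect_eq)
  then have "f (H c) * g (H c) \<noteq> 0" using AB by simp
  then show ?thesis
    by (intro for_general_formsI[OF polynomial_on_mult[OF f(1) g(1)] H[of c]])
       (use f(4) g(4) in auto)
qed

lemma for_general_forms_True: "for_general_forms r d (\<lambda>F. True)"
  using form_tuples_nonempty[of r d]
  by (auto intro: for_general_formsI[OF polynomial_on_const[of r d 1]])

lemma for_general_forms_ball:
  fixes P :: "'a \<Rightarrow> (nat \<Rightarrow> ('v::finite, 'k::field) mpoly) \<Rightarrow> bool"
  assumes inf: "infinite (UNIV :: 'k set)" and "finite A"
    and "\<And>x. x \<in> A \<Longrightarrow> for_general_forms r d (P x)"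
  shows "for_general_forms r d (\<lambda>F. \<forall>x\<in>A. P x F)"
  using assms(2,3)
proof (induction A)
  case empty
  show ?case using for_general_forms_True by simp
next
  case (insert x A)
  then show ?case using for_general_forms_conj[OF inf, of r d "P x"] by simp
qed

text \<open>
  Selecting some members of a tuple is a surjective linear map between spaces of tuples, so
  the preimage of a nonempty open set is open and nonempty. This allows an assumption about \<open>s\<close>
  general forms to be used for any \<open>s\<close> members of a longer tuple.
\<close>

lemma for_general_forms_reindex:
  fixes P :: "(nat \<Rightarrow> ('v::finite, 'k::field) mpoly) \<Rightarrow> bool"
  assumes h: "inj_on h {..<s}" "h ` {..<s} \<subseteq> {..<r}"
    and P: "for_general_forms s (\<lambda>j. d (h j)) P"
  shows "for_general_forms r d (\<lambda>F. P (\<lambda>j\<in>{..<s}. F (h j)))"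
proof -
  let ?R = "\<lambda>F :: nat \<Rightarrow> ('v, 'k) mpoly. \<lambda>j\<in>{..<s}. F (h j)"
  obtain f G0 p where G0: "G0 \<in> form_tuples s (\<lambda>j. d (h j))" "f G0 \<noteq> 0"
    and p: "\<And>F. F \<in> form_tuples s (\<lambda>j. d (h j)) \<Longrightarrow>
        f F = mpoly_eval p (\<lambda>(i, m). Poly_Mapping.lookup (F i) m)"
    and P: "\<And>F. F \<in> form_tuples s (\<lambda>j. d (h j)) \<Longrightarrow> f F \<noteq> 0 \<Longrightarrow> P F"
    using P unfolding for_general_forms_iff polynomial_on_def by blast
  have R: "?R F \<in> form_tuples s (\<lambda>j. d (h j))" if "F \<in> form_tuples r d" for F
    using that h(2) unfolding form_tuples_def by (fastforce simp: PiE_iff)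
  have "polynomial_on r d (\<lambda>F. mpoly_eval p (\<lambda>(i, m). Poly_Mapping.lookup (?R F i) m))"
    unfolding mpoly_eval_def
  proof (intro polynomial_on_sum polynomial_on_mult polynomial_on_const polynomial_on_prod
      polynomial_on_power)
    fix x :: "nat \<times> ('v \<Rightarrow>\<^sub>0 nat)"
    show "polynomial_on r d (\<lambda>F. (\<lambda>(i, m). Poly_Mapping.lookup (?R F i) m) x)"
    proof (cases "fst x < s")
      case True
      then show ?thesis
        using polynomial_on_coeff[of r d "h (fst x)" "snd x"] by (simp add: case_prod_unfold)
    next
      case False
      then show ?thesis by (simp add: case_prod_unfold polynomial_on_const)
    qed
  qed
  then have poly: "polynomial_on r d (\<lambda>F. f (?R F))"
    by (rule polynomial_on_cong) (simp add: p R)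
  \<comment> \<open>The preimage is nonempty: \<open>G0\<close> extends by zero forms.\<close>
  define F0 where "F0 = (\<lambda>i\<in>{..<r}. if i \<in> h ` {..<s} then G0 (the_inv_into {..<s} h i) else 0)"
  have F0: "F0 \<in> form_tuples r d"
    using G0(1) h unfolding form_tuples_def F0_def
    by (auto simp: PiE_iff forms_zero the_inv_into_f_f)
  have "?R F0 = G0"
    using G0(1) h unfolding form_tuples_def F0_def
    by (auto simp: PiE_iff the_inv_into_f_f fun_eq_iff restrict_def extensional_def)
  then show ?thesis
    using for_general_formsI[OF poly F0] G0(2) P R by metis
qed

section \<open>Homogeneous polynomials\<close>

text \<open>
  Degrees are integers, so that differences of degrees need no side condition: a homogeneous
  polynomial of negative degree is \<open>0\<close>.
\<close>

definition homogeneous :: "int \<Rightarrow> ('v::finite, 'k::field) mpoly \<Rightarrow> bool" where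
  "homogeneous z p \<longleftrightarrow> (\<forall>m\<in>Poly_Mapping.keys p. int (mdeg m) = z)"

lemma forms_iff_homogeneous: "p \<in> forms e \<longleftrightarrow> homogeneous (int e) p"
  by (simp add: forms_def homogeneous_def)

lemma homogeneous_zero [simp]: "homogeneous z 0"
  by (simp add: homogeneous_def)

lemma homogeneous_uminus: "homogeneous z p \<Longrightarrow> homogeneous z (- p)"
  by (auto simp: homogeneous_def in_keys_iff)

lemma homogeneous_add: "homogeneous z p \<Longrightarrow> homogeneous z q \<Longrightarrow> homogeneous z (p + q)"
  using keys_add[of p q] by (auto simp: homogeneous_def)

lemma homogeneous_diff: "homogeneous z p \<Longrightarrow> homogeneous z q \<Longrightarrow> homogeneous z (p - q)"
  using homogeneous_add[of z p "- q"] homogeneous_uminus[of z q] by simp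

lemma homogeneous_sum: "(\<And>x. x \<in> A \<Longrightarrow> homogeneous z (f x)) \<Longrightarrow> homogeneous z (\<Sum>x\<in>A. f x)"
  by (induction A rule: infinite_finite_induct) (auto intro: homogeneous_add)

lemma mdeg_add: "mdeg (m + m') = mdeg m + mdeg m'"
  by (simp add: mdeg_def lookup_add sum.distrib)

lemma homogeneous_mult: "homogeneous a p \<Longrightarrow> homogeneous b q \<Longrightarrow> homogeneous (a + b) (p * q)"
  using keys_mult[of p q] by (fastforce simp: homogeneous_def mdeg_add)

lemma homogeneous_const: "homogeneous 0 (Poly_Mapping.single 0 c)"
  by (simp add: homogeneous_def mdeg_def)

lemma homogeneous_negative: "homogeneous z p \<Longrightarrow> z < 0 \<Longrightarrow> p = 0"
  unfolding homogeneous_def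
  by (metis all_not_in_conv keys_eq_empty of_nat_0_le_iff not_le)

lemma homogeneous_lookup_zero: "homogeneous z p \<Longrightarrow> Poly_Mapping.lookup p 0 \<noteq> 0 \<Longrightarrow> z = 0"
  unfolding homogeneous_def by (force simp: mdeg_def in_keys_iff)

definition homogeneous_part :: "int \<Rightarrow> ('v::finite, 'k::field) mpoly \<Rightarrow> ('v, 'k) mpoly" where
  "homogeneous_part z p = (\<Sum>m | m \<in> Poly_Mapping.keys p \<and> int (mdeg m) = z.
     Poly_Mapping.single m (Poly_Mapping.lookup p m))"

lemma lookup_homogeneous_part:
  "Poly_Mapping.lookup (homogeneous_part z p) m
    = (if int (mdeg m) = z then Poly_Mapping.lookup p m else 0)"
proof -
  have "Poly_Mapping.lookup (homogeneous_part z p) m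
      = (\<Sum>m' | m' \<in> Poly_Mapping.keys p \<and> int (mdeg m') = z.
          if m' = m then Poly_Mapping.lookup p m else 0)"
    unfolding homogeneous_part_def lookup_sum
    by (intro sum.cong) (auto simp: lookup_single when_def)
  then show ?thesis by (auto simp: sum.delta' in_keys_iff)
qed

lemma homogeneous_homogeneous_part: "homogeneous z (homogeneous_part z p)"
  by (auto simp: homogeneous_def in_keys_iff lookup_homogeneous_part split: if_splits)

lemma homogeneous_part_add: "homogeneous_part z (p + q) = homogeneous_part z p + homogeneous_part z q"
  by (rule poly_mapping_eqI) (simp add: lookup_homogeneous_part lookup_add)

lemma homogeneous_part_zero [simp]: "homogeneous_part z 0 = 0"
  by (rule poly_mapping_eqI) (simp add: lookup_homogeneous_part)

lemma homogeneous_part_sum: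
  "homogeneous_part z (\<Sum>x\<in>A. f x) = (\<Sum>x\<in>A. homogeneous_part z (f x))"
  by (induction A rule: infinite_finite_induct) (auto simp: homogeneous_part_add)

lemma homogeneous_part_id: "homogeneous z p \<Longrightarrow> homogeneous_part z p = p"
  by (rule poly_mapping_eqI) (auto simp: lookup_homogeneous_part homogeneous_def in_keys_iff)

lemma homogeneous_part_mult:
  assumes "homogeneous a p"
  shows "homogeneous_part (a + b) (p * q) = p * homogeneous_part b q"
proof -
  let ?q = "q - homogeneous_part b q"
  have "Poly_Mapping.lookup (homogeneous_part (a + b) (p * ?q)) m = 0" for m
  proof (rule ccontr)
    assume "Poly_Mapping.lookup (homogeneous_part (a + b) (p * ?q)) m \<noteq> 0"
    then have "m \<in> Poly_Mapping.keys (p * ?q)" and m: "int (mdeg m) = a + b"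
      by (auto simp: lookup_homogeneous_part in_keys_iff split: if_splits)
    then obtain m1 m2 where "m = m1 + m2" "m1 \<in> Poly_Mapping.keys p" "m2 \<in> Poly_Mapping.keys ?q"
      using keys_mult[of p ?q] by blast
    moreover from this(3) have "int (mdeg m2) \<noteq> b"
      by (auto simp: in_keys_iff lookup_minus lookup_homogeneous_part split: if_splits)
    ultimately show False using m assms by (auto simp: mdeg_add homogeneous_def)
  qed
  then have "homogeneous_part (a + b) (p * ?q) = 0" by (intro poly_mapping_eqI) simp
  moreover have "p * q = p * ?q + p * homogeneous_part b q" by (simp add: algebra_simps)
  moreover have "homogeneous_part (a + b) (p * homogeneous_part b q) = p * homogeneous_part b q"
    by (intro homogeneous_part_id homogeneous_mult assms homogeneous_homogeneous_part)
  ultimately show ?thesis by (simp add: homogeneous_part_add)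
qed

lemma finite_mdeg: "finite {m :: 'v::finite \<Rightarrow>\<^sub>0 nat. int (mdeg m) = z}"
proof (rule finite_imageD)
  show "inj_on Poly_Mapping.lookup {m :: 'v \<Rightarrow>\<^sub>0 nat. int (mdeg m) = z}"
    by (intro inj_onI poly_mapping_eqI) simp
  have "Poly_Mapping.lookup m v \<le> nat z" if "int (mdeg m) = z" for m :: "'v \<Rightarrow>\<^sub>0 nat" and v
  proof -
    have "nat z = mdeg m" using that by auto
    then show ?thesis
      using member_le_sum[of v UNIV "Poly_Mapping.lookup m"] by (simp add: mdeg_def)
  qed
  then have "Poly_Mapping.lookup ` {m :: 'v \<Rightarrow>\<^sub>0 nat. int (mdeg m) = z} \<subseteq> UNIV \<rightarrow>\<^sub>E {..nat z}"
    by (auto simp: PiE_iff)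
  then show "finite (Poly_Mapping.lookup ` {m :: 'v \<Rightarrow>\<^sub>0 nat. int (mdeg m) = z})"
    by (rule finite_subset) (simp add: finite_PiE)
qed

section \<open>Linear maps depending polynomially on the forms\<close>

abbreviation poly_scale :: "'k::field \<Rightarrow> ('v, 'k) mpoly \<Rightarrow> ('v, 'k) mpoly" where
  "poly_scale c p \<equiv> Poly_Mapping.single 0 c * p"

definition tuple_scale :: "'k::field \<Rightarrow> ('x \<Rightarrow> ('v, 'k) mpoly) \<Rightarrow> 'x \<Rightarrow> ('v, 'k) mpoly" where
  "tuple_scale c y = (\<lambda>x. poly_scale c (y x))"

lemma vector_space_poly: "vector_space (poly_scale :: 'k::field \<Rightarrow> ('v, 'k) mpoly \<Rightarrow> _)"
  by unfold_locales
     (simp_all add: distrib_left distrib_right single_add mult_single flip: mult.assoc)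

lemma vector_space_tuple:
  "vector_space (tuple_scale :: 'k::field \<Rightarrow> ('x \<Rightarrow> ('v, 'k) mpoly) \<Rightarrow> _)"
  by unfold_locales
     (simp_all add: tuple_scale_def fun_eq_iff distrib_left distrib_right single_add mult_single
       flip: mult.assoc)

lemma vector_space_field: "vector_space ((*) :: 'k::field \<Rightarrow> 'k \<Rightarrow> 'k)"
  by unfold_locales (simp_all add: algebra_simps)

lemma linearI:
  assumes "vector_space s1" "vector_space s2"
    "\<And>x y. f (x + y) = f x + f y" "\<And>c x. f (s1 c x) = s2 c (f x)"
  shows "Vector_Spaces.linear s1 s2 f"
  by (intro Vector_Spaces.linear.intro module_hom.intro module_hom_axioms.intro assms
      assms(1,2)[unfolded module_iff_vector_space[symmetric]])

text \<open>
  Polynomial dependence of a vector on \<open>F\<close>, tested by linear functionals. With this definition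
  a fixed linear map preserves polynomial families for trivial reasons, and bases are needed
  only where a determinant is formed.
\<close>

definition polynomial_family ::
  "('k::field \<Rightarrow> 'b::ab_group_add \<Rightarrow> 'b) \<Rightarrow> nat \<Rightarrow> (nat \<Rightarrow> nat) \<Rightarrow>
   ((nat \<Rightarrow> ('v::finite, 'k) mpoly) \<Rightarrow> 'b) \<Rightarrow> bool" where
  "polynomial_family scale r d G \<longleftrightarrow>
     (\<forall>l. Vector_Spaces.linear scale (*) l \<longrightarrow> polynomial_on r d (\<lambda>F. l (G F)))"

lemma polynomial_family_const: "polynomial_family scale r d (\<lambda>F. v)"
  by (simp add: polynomial_family_def polynomial_on_const)

lemma polynomial_family_linear:
  assumes "polynomial_family s1 r d G" "Vector_Spaces.linear s1 s2 L"
  shows "polynomial_family s2 r d (\<lambda>F. L (G F))"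
  unfolding polynomial_family_def
proof (intro allI impI)
  fix l assume "Vector_Spaces.linear s2 (*) l"
  then have "Vector_Spaces.linear s1 (*) (l \<circ> L)" using assms(2) by (rule Vector_Spaces.linear_compose[rotated])
  then show "polynomial_on r d (\<lambda>F. l (L (G F)))"
    using assms(1) unfolding polynomial_family_def by fastforce
qed

lemma polynomial_family_add:
  assumes "polynomial_family s r d G" "polynomial_family s r d H"
  shows "polynomial_family s r d (\<lambda>F. G F + H F)"
  using assms unfolding polynomial_family_def
  by (auto simp: module_hom.add[OF Vector_Spaces.linear.axioms(3)] intro: polynomial_on_add)

lemma polynomial_family_sum:
  assumes "\<And>x. x \<in> A \<Longrightarrow> polynomial_family s r d (G x)"
  shows "polynomial_family s r d (\<lambda>F. \<Sum>x\<in>A. G x F)"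
  using assms
  by (induction A rule: infinite_finite_induct)
     (auto intro: polynomial_family_const polynomial_family_add)

lemma polynomial_family_form:
  assumes "i < r"
  shows "polynomial_family poly_scale r d (\<lambda>F :: nat \<Rightarrow> ('v::finite, 'k::field) mpoly. F i)"
  unfolding polynomial_family_def
proof (intro allI impI)
  fix l :: "('v, 'k) mpoly \<Rightarrow> 'k" assume l: "Vector_Spaces.linear poly_scale (*) l"
  interpret l: Vector_Spaces.linear poly_scale "(*)" l by fact
  let ?B = "{m :: 'v \<Rightarrow>\<^sub>0 nat. int (mdeg m) = int (d i)}"
  have "l (F i) = (\<Sum>m\<in>?B. Poly_Mapping.lookup (F i) m * l (Poly_Mapping.single m 1))"
    if "F \<in> form_tuples r d" for F
  proof -
    have "Poly_Mapping.keys (F i) \<subseteq> ?B"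
      using that assms by (auto simp: form_tuples_def PiE_iff forms_def)
    then have "(\<Sum>m\<in>?B. Poly_Mapping.lookup (F i) m * l (Poly_Mapping.single m 1))
        = (\<Sum>m\<in>Poly_Mapping.keys (F i). Poly_Mapping.lookup (F i) m * l (Poly_Mapping.single m 1))"
      by (intro sum.mono_neutral_right finite_mdeg) (auto simp: in_keys_iff)
    also have "\<dots> = l (\<Sum>m\<in>Poly_Mapping.keys (F i).
        Poly_Mapping.single m (Poly_Mapping.lookup (F i) m))"
      by (simp add: l.sum mult_single flip: l.scale)
    finally show ?thesis by (simp add: sum_single_lookup)
  qed
  moreover have "polynomial_on r d
      (\<lambda>F. \<Sum>m\<in>?B. Poly_Mapping.lookup (F i) m * l (Poly_Mapping.single m 1))"
    by (intro polynomial_on_sum polynomial_on_mult polynomial_on_coeff polynomial_on_const)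
  ultimately show "polynomial_on r d (\<lambda>F. l (F i))"
    by (metis (no_types, lifting) polynomial_on_cong)
qed

text \<open>
  In the basis \<open>e\<close> with coordinates \<open>c\<close>, the restriction of \<open>M F\<close> to \<open>V\<close> is a square matrix whose
  entries are polynomial functions of \<open>F\<close>. Its determinant is one as well, and it is \<open>1\<close> at \<open>F0\<close>;
  where it does not vanish, \<open>M F\<close> is bijective on \<open>V\<close>.
\<close>

lemma bijective_near_identity:
  fixes scale :: "'k::field \<Rightarrow> 'b::ab_group_add \<Rightarrow> 'b" and c :: "'i \<Rightarrow> 'b \<Rightarrow> 'k" and e :: "'i \<Rightarrow> 'b"
    and M :: "(nat \<Rightarrow> ('v::finite, 'k) mpoly) \<Rightarrow> 'b \<Rightarrow> 'b"
  assumes vs: "vector_space scale" and V: "module.subspace scale V" and fin: "finite I"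
    and c: "\<And>i. i \<in> I \<Longrightarrow> Vector_Spaces.linear scale (*) (c i)"
    and e: "\<And>i. i \<in> I \<Longrightarrow> e i \<in> V"
    and dual: "\<And>i j. i \<in> I \<Longrightarrow> j \<in> I \<Longrightarrow> c i (e j) = (if i = j then 1 else 0)"
    and expand: "\<And>v. v \<in> V \<Longrightarrow> (\<Sum>i\<in>I. scale (c i v) (e i)) = v"
    and M: "\<And>F. Vector_Spaces.linear scale scale (M F)"
    and MV: "\<And>F v. F \<in> form_tuples r d \<Longrightarrow> v \<in> V \<Longrightarrow> M F v \<in> V"
    and poly: "\<And>v. polynomial_family scale r d (\<lambda>F. M F v)"
    and F0: "F0 \<in> form_tuples r d" and id: "\<And>v. v \<in> V \<Longrightarrow> M F0 v = v"
  shows "for_general_forms r d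
    (\<lambda>F. (\<forall>v\<in>V. M F v = 0 \<longrightarrow> v = 0) \<and> (\<forall>v\<in>V. \<exists>w\<in>V. M F w = v))"
proof -
  interpret vector_space scale by fact
  define N where "N = card I"
  obtain h where h: "bij_betw h {0..<N} I" using ex_bij_betw_nat_finite[OF fin] N_def by auto
  have hI: "a < N \<Longrightarrow> h a \<in> I" for a using h by (auto simp: bij_betw_def)
  have heq: "a < N \<Longrightarrow> b < N \<Longrightarrow> h a = h b \<longleftrightarrow> a = b" for a b
    using h by (auto simp: bij_betw_def inj_on_def)
  have expand': "(\<Sum>b\<in>{0..<N}. scale (c (h b) v) (e (h b))) = v" if "v \<in> V" for v
    using expand[OF that] sum.reindex_bij_betw[OF h, of "\<lambda>i. scale (c i v) (e i)"] by simp
  define A where "A F = mat N N (\<lambda>(a, b). c (h a) (M F (e (h b))))" for F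
  have A: "A F \<in> carrier_mat N N" for F by (simp add: A_def)
  have A_mult: "(A F *\<^sub>v x) $ a = c (h a) (M F (\<Sum>b\<in>{0..<N}. scale (x $ b) (e (h b))))"
    if "x \<in> carrier_vec N" "a < N" for F x a
  proof -
    interpret M: Vector_Spaces.linear scale scale "M F" by (rule M)
    interpret c: Vector_Spaces.linear scale "(*)" "c (h a)" by (rule c[OF hI[OF that(2)]])
    show ?thesis
      using that by (simp add: A_def scalar_prod_def M.sum M.scale c.sum c.scale mult_ac)
  qed
  have "polynomial_on r d (\<lambda>F. det (A F))"
    unfolding det_def'[OF A]
  proof (intro polynomial_on_sum polynomial_on_mult polynomial_on_const polynomial_on_prod)
    fix p a assume "p \<in> {p. p permutes {0..<N}}" and a: "a \<in> {0..<N}"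
    then have pa: "p a < N" using permutes_in_image[of p "{0..<N}" a] by auto
    then have "(\<lambda>F. A F $$ (a, p a)) = (\<lambda>F. c (h a) (M F (e (h (p a)))))"
      using a by (simp add: A_def)
    then show "polynomial_on r d (\<lambda>F. A F $$ (a, p a))"
      using poly c[OF hI] a unfolding polynomial_family_def by auto
  qed
  moreover note F0
  moreover have "A F0 = 1\<^sub>m N"
    by (rule eq_matI) (auto simp: A_def id e hI dual heq)
  then have "det (A F0) \<noteq> 0" by simp
  ultimately show ?thesis
  proof (rule for_general_formsI)
    fix F assume F: "F \<in> form_tuples r d" and "det (A F) \<noteq> 0"
    from det_non_zero_imp_unit[OF A this(2), of "()"]
    obtain B where BA: "B * A F = 1\<^sub>m N" and AB: "A F * B = 1\<^sub>m N" and B: "B \<in> carrier_mat N N"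
      unfolding Units_def ring_mat_def by auto
    interpret M: Vector_Spaces.linear scale scale "M F" by (rule M)
    show "(\<forall>v\<in>V. M F v = 0 \<longrightarrow> v = 0) \<and> (\<forall>v\<in>V. \<exists>w\<in>V. M F w = v)"
    proof (intro conjI ballI impI)
      fix v assume v: "v \<in> V" and Mv: "M F v = 0"
      let ?x = "vec N (\<lambda>b. c (h b) v)"
      have "(A F *\<^sub>v ?x) $ a = 0" if a: "a < N" for a
      proof -
        interpret c: Vector_Spaces.linear scale "(*)" "c (h a)" by (rule c[OF hI[OF a]])
        show ?thesis using A_mult[of ?x a F] a expand'[OF v] Mv by simp
      qed
      then have "A F *\<^sub>v ?x = 0\<^sub>v N" using A by (intro eq_vecI) auto
      moreover have "?x = B *\<^sub>v (A F *\<^sub>v ?x)"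
        using assoc_mult_mat_vec[OF B A[of F], of ?x] BA by simp
      ultimately have "?x = B *\<^sub>v 0\<^sub>v N" by simp
      also have "\<dots> = 0\<^sub>v N" using B by (intro eq_vecI) (auto simp: scalar_prod_def)
      finally have "?x = 0\<^sub>v N" .
      then have "c (h b) v = 0" if "b < N" for b using that by (metis index_vec index_zero_vec(1))
      then show "v = 0" using expand'[OF v] by simp
    next
      fix v assume v: "v \<in> V"
      let ?y = "vec N (\<lambda>b. c (h b) v)"
      define x where "x = B *\<^sub>v ?y"
      have x: "x \<in> carrier_vec N" using B by (simp add: x_def)
      define w where "w = (\<Sum>b\<in>{0..<N}. scale (x $ b) (e (h b)))"
      have w: "w \<in> V" unfolding w_def
        by (intro subspace_sum subspace_scale V e hI) auto
      have "A F *\<^sub>v x = ?y" unfolding x_def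
        using assoc_mult_mat_vec[OF A[of F] B, of ?y] AB by simp
      then have coord: "c (h a) (M F w) = c (h a) v" if "a < N" for a
        using A_mult[OF x that, of F] that by (simp add: w_def)
      have "M F w = (\<Sum>b\<in>{0..<N}. scale (c (h b) (M F w)) (e (h b)))"
        by (rule expand'[OF MV[OF F w], symmetric])
      also have "\<dots> = (\<Sum>b\<in>{0..<N}. scale (c (h b) v) (e (h b)))"
        by (intro sum.cong refl) (simp add: coord)
      also have "\<dots> = v" by (rule expand'[OF v])
      finally have "M F w = v" .
      then show "\<exists>w\<in>V. M F w = v" using w by blast
    qed
  qed
qed

lemma sum_apply: "(\<Sum>i\<in>A. f i) x = (\<Sum>i\<in>A. f i x)"
  for f :: "'a \<Rightarrow> 'b \<Rightarrow> 'c::comm_monoid_add"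
  by (induction A rule: infinite_finite_induct) auto

section \<open>Graded pieces of free modules\<close>

text \<open>
  The degree \<open>t\<close> part of the free module with basis \<open>X\<close>, the basis element \<open>x\<close> having degree \<open>a x\<close>.
  Functions that vanish outside \<open>X\<close> make this a subspace of a type that does not depend on \<open>X\<close>.
\<close>

definition graded_piece ::
  "'x set \<Rightarrow> ('x \<Rightarrow> int) \<Rightarrow> int \<Rightarrow> ('x \<Rightarrow> ('v::finite, 'k::field) mpoly) set" where
  "graded_piece X a t = {y. (\<forall>x\<in>X. homogeneous (t - a x) (y x)) \<and> (\<forall>x. x \<notin> X \<longrightarrow> y x = 0)}"

lemma subspace_graded_piece:
  "module.subspace tuple_scale (graded_piece X a t :: ('x \<Rightarrow> ('v::finite, 'k::field) mpoly) set)"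
proof -
  interpret vector_space "tuple_scale :: 'k::field \<Rightarrow> ('x \<Rightarrow> ('v::finite, 'k) mpoly) \<Rightarrow> _"
    by (rule vector_space_tuple)
  have "homogeneous z (poly_scale c p)" if "homogeneous z p" for z c and p :: "('v, 'k) mpoly"
    using homogeneous_mult[OF homogeneous_const that] by simp
  then show ?thesis
    by (auto simp: subspace_def graded_piece_def tuple_scale_def intro: homogeneous_add)
qed

text \<open>
  A graded piece has the finite basis of the monomial multiples of basis elements, with the coefficients
  as coordinates.
\<close>

lemma bijective_near_identity_graded_piece:
  fixes M :: "(nat \<Rightarrow> ('v::finite, 'k::field) mpoly) \<Rightarrow> ('x \<Rightarrow> ('v, 'k) mpoly) \<Rightarrow> 'x \<Rightarrow> ('v, 'k) mpoly"
    and X :: "'x set" and a :: "'x \<Rightarrow> int" and t :: int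
  defines "V \<equiv> graded_piece X a t"
  assumes X: "finite X"
    and M: "\<And>F. Vector_Spaces.linear tuple_scale tuple_scale (M F)"
    and MV: "\<And>F v. F \<in> form_tuples r d \<Longrightarrow> v \<in> V \<Longrightarrow> M F v \<in> V"
    and poly: "\<And>v. polynomial_family tuple_scale r d (\<lambda>F. M F v)"
    and F0: "F0 \<in> form_tuples r d" and id: "\<And>v. v \<in> V \<Longrightarrow> M F0 v = v"
  shows "for_general_forms r d
    (\<lambda>F. (\<forall>v\<in>V. M F v = 0 \<longrightarrow> v = 0) \<and> (\<forall>v\<in>V. \<exists>w\<in>V. M F w = v))"
proof (rule bijective_near_identity[OF vector_space_tuple _ _ _ _ _ _ M MV poly F0 id])
  let ?I = "SIGMA x:X. {m :: 'v \<Rightarrow>\<^sub>0 nat. int (mdeg m) = t - a x}"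
  let ?c = "\<lambda>(x, m) (y :: 'x \<Rightarrow> ('v, 'k) mpoly). Poly_Mapping.lookup (y x) m"
  let ?e = "\<lambda>(x, m) x'. if x' = x then Poly_Mapping.single m 1 else (0 :: ('v, 'k) mpoly)"
  show "module.subspace tuple_scale V" unfolding V_def by (rule subspace_graded_piece)
  show "finite ?I" using X finite_mdeg by (intro finite_SigmaI) auto
  show "Vector_Spaces.linear tuple_scale (*) (?c i)" for i
    by (intro linearI vector_space_tuple vector_space_field)
       (auto simp: case_prod_unfold lookup_add tuple_scale_def lookup_constant_mult)
  show "?e i \<in> V" if "i \<in> ?I" for i
    using that by (auto simp: V_def graded_piece_def homogeneous_def split: if_splits)
  show "?c i (?e j) = (if i = j then 1 else 0)" for i j
    by (auto simp: case_prod_unfold lookup_single when_def prod_eq_iff)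
  show "(\<Sum>i\<in>?I. tuple_scale (?c i v) (?e i)) = v" if v: "v \<in> V" for v
  proof (intro ext poly_mapping_eqI)
    fix x m
    have "Poly_Mapping.lookup ((\<Sum>i\<in>?I. tuple_scale (?c i v) (?e i)) x) m
        = (\<Sum>i\<in>?I. if i = (x, m) then Poly_Mapping.lookup (v x) m else 0)"
      unfolding sum_apply lookup_sum
      by (intro sum.cong) (auto simp: tuple_scale_def lookup_constant_mult lookup_single when_def split: if_splits)
    also have "\<dots> = (if (x, m) \<in> ?I then Poly_Mapping.lookup (v x) m else 0)"
      using \<open>finite ?I\<close> by simp
    also have "\<dots> = Poly_Mapping.lookup (v x) m"
      using v by (cases "x \<in> X") (force simp: V_def graded_piece_def homogeneous_def in_keys_iff)+
    finally show "Poly_Mapping.lookup ((\<Sum>i\<in>?I. tuple_scale (?c i v) (?e i)) x) m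
      = Poly_Mapping.lookup (v x) m" .
  qed
qed

section \<open>Exactness of the Koszul complex in one degree\<close>

text \<open>
  The differential \<open>K\<^sub>1 \<rightarrow> K\<^sub>0 = R\<close> of the Koszul complex on the forms \<open>F i\<close>, \<open>i \<in> S\<close>.
\<close>

definition relation_sum ::
  "nat set \<Rightarrow> (nat \<Rightarrow> ('v::finite, 'k::field) mpoly) \<Rightarrow> (nat \<Rightarrow> ('v, 'k) mpoly) \<Rightarrow> ('v, 'k) mpoly" where
  "relation_sum S F y = (\<Sum>i\<in>S. y i * F i)"

text \<open>
  The differential \<open>K\<^sub>2 \<rightarrow> K\<^sub>1\<close>. An element of \<open>K\<^sub>2\<close> is represented by an arbitrary matrix \<open>u\<close>, of which
  only the antisymmetric part \<open>u (i, j) - u (j, i)\<close> counts. In this form the differential is linear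
  on all of \<open>S \<times> S\<close> and does not refer to the order of the indices.
\<close>

definition koszul_boundary ::
  "nat set \<Rightarrow> (nat \<Rightarrow> ('v::finite, 'k::field) mpoly) \<Rightarrow> (nat \<times> nat \<Rightarrow> ('v, 'k) mpoly) \<Rightarrow>
   nat \<Rightarrow> ('v, 'k) mpoly" where
  "koszul_boundary S F u = (\<lambda>i. if i \<in> S then \<Sum>j\<in>S. (u (i, j) - u (j, i)) * F j else 0)"

abbreviation koszul1_piece :: "nat set \<Rightarrow> (nat \<Rightarrow> nat) \<Rightarrow> nat \<Rightarrow> (nat \<Rightarrow> ('v::finite, 'k::field) mpoly) set"
  where "koszul1_piece S d t \<equiv> graded_piece S (\<lambda>i. int (d i)) (int t)"

abbreviation koszul2_piece ::
  "nat set \<Rightarrow> (nat \<Rightarrow> nat) \<Rightarrow> nat \<Rightarrow> (nat \<times> nat \<Rightarrow> ('v::finite, 'k::field) mpoly) set"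
  where "koszul2_piece S d t \<equiv> graded_piece (S \<times> S) (\<lambda>(i, j). int (d i) + int (d j)) (int t)"

text \<open>
  Exactness at \<open>K\<^sub>1\<close> in degree \<open>t\<close>: all relations of degree \<open>t\<close> are combinations of Koszul relations.
\<close>

definition koszul_exact ::
  "nat set \<Rightarrow> (nat \<Rightarrow> nat) \<Rightarrow> nat \<Rightarrow> (nat \<Rightarrow> ('v::finite, 'k::field) mpoly) \<Rightarrow> bool" where
  "koszul_exact S d t F \<longleftrightarrow>
     (\<forall>y\<in>koszul1_piece S d t. relation_sum S F y = 0 \<longrightarrow>
        (\<exists>u\<in>koszul2_piece S d t. koszul_boundary S F u = y))"

text \<open>
  The forms \<open>F i\<close>, \<open>i \<in> S\<close>, generate an ideal that contains \<open>R\<^sub>t\<close>.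
\<close>

definition spans_degree ::
  "nat set \<Rightarrow> nat \<Rightarrow> (nat \<Rightarrow> ('v::finite, 'k::field) mpoly) \<Rightarrow> bool" where
  "spans_degree S t F \<longleftrightarrow> (\<forall>f\<in>forms t. \<exists>y. relation_sum S F y = f)"

lemma form_tuplesD: "F \<in> form_tuples r d \<Longrightarrow> i < r \<Longrightarrow> homogeneous (int (d i)) (F i)"
  by (auto simp: form_tuples_def PiE_iff forms_iff_homogeneous)

text \<open>
  Only the parts of the coefficients \<open>g i\<close> of degree \<open>t - d i\<close> contribute to the part of degree \<open>t\<close>.
\<close>

lemma homogeneous_coefficients:
  assumes F: "\<And>i. i \<in> S \<Longrightarrow> homogeneous (int (d i)) (F i)" and f: "homogeneous t f"
    and eq: "relation_sum S F g = f"
  obtains y where "y \<in> graded_piece S (\<lambda>i. int (d i)) t" "relation_sum S F y = f"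
proof
  let ?y = "\<lambda>i. if i \<in> S then homogeneous_part (t - int (d i)) (g i) else 0"
  show "?y \<in> graded_piece S (\<lambda>i. int (d i)) t"
    by (simp add: graded_piece_def homogeneous_homogeneous_part)
  have part: "homogeneous_part t (g i * F i) = homogeneous_part (t - int (d i)) (g i) * F i"
    if "i \<in> S" for i
    using homogeneous_part_mult[OF F[OF that], of "t - int (d i)" "g i"] by (simp add: mult.commute)
  have "f = homogeneous_part t f" using homogeneous_part_id[OF f] by simp
  also have "\<dots> = (\<Sum>i\<in>S. homogeneous_part t (g i * F i))"
    unfolding eq[symmetric] relation_sum_def homogeneous_part_sum ..
  also have "\<dots> = relation_sum S F ?y"
    unfolding relation_sum_def by (intro sum.cong refl) (simp add: part)
  finally show "relation_sum S F ?y = f" by simp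
qed

lemma linear_relation_sum: "Vector_Spaces.linear tuple_scale poly_scale (relation_sum S F)"
  by (intro linearI vector_space_tuple vector_space_poly)
     (simp_all add: relation_sum_def tuple_scale_def sum.distrib sum_distrib_left algebra_simps)

lemma linear_koszul_boundary: "Vector_Spaces.linear tuple_scale tuple_scale (koszul_boundary S F)"
  by (intro linearI vector_space_tuple ext)
     (simp_all add: koszul_boundary_def tuple_scale_def sum_distrib_left algebra_simps
        flip: sum.distrib)

lemma relation_sum_boundary: "relation_sum S F (koszul_boundary S F u) = 0"
proof -
  have "relation_sum S F (koszul_boundary S F u)
      = (\<Sum>i\<in>S. \<Sum>j\<in>S. u (i, j) * F j * F i) - (\<Sum>i\<in>S. \<Sum>j\<in>S. u (j, i) * F j * F i)"
    by (simp add: relation_sum_def koszul_boundary_def sum_distrib_right left_diff_distrib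
        sum_subtractf)
  also have "(\<Sum>i\<in>S. \<Sum>j\<in>S. u (j, i) * F j * F i) = (\<Sum>i\<in>S. \<Sum>j\<in>S. u (i, j) * F j * F i)"
    by (subst sum.swap) (simp add: mult_ac)
  finally show ?thesis by simp
qed

lemma koszul_boundary_in_piece:
  assumes "\<And>i. i \<in> S \<Longrightarrow> homogeneous (int (d i)) (F i)" "u \<in> koszul2_piece S d t"
  shows "koszul_boundary S F u \<in> koszul1_piece S d t"
proof -
  have "homogeneous (int t - int (d i)) ((u (i, j) - u (j, i)) * F j)" if "i \<in> S" "j \<in> S" for i j
  proof -
    have "homogeneous (int t - (int (d i) + int (d j))) (u (i, j) - u (j, i))"
      using assms(2) that by (auto simp: graded_piece_def add.commute intro!: homogeneous_diff)
    from homogeneous_mult[OF this assms(1)[OF that(2)]] show ?thesis by simp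
  qed
  then show ?thesis by (auto simp: graded_piece_def koszul_boundary_def intro: homogeneous_sum)
qed

lemma polynomial_family_relation_sum:
  assumes "S \<subseteq> {..<r}"
  shows "polynomial_family poly_scale r d (\<lambda>F. relation_sum S F y)"
  unfolding relation_sum_def
proof (rule polynomial_family_sum)
  fix i assume "i \<in> S"
  then have "polynomial_family poly_scale r d (\<lambda>F. F i)"
    using assms by (intro polynomial_family_form) auto
  moreover have "Vector_Spaces.linear poly_scale poly_scale (\<lambda>p. y i * p)"
    by (intro linearI vector_space_poly) (simp_all add: algebra_simps)
  ultimately show "polynomial_family poly_scale r d (\<lambda>F. y i * F i)"
    by (rule polynomial_family_linear)
qed

lemma polynomial_family_koszul_boundary:
  assumes "S \<subseteq> {..<r}"
  shows "polynomial_family tuple_scale r d (\<lambda>F. koszul_boundary S F u)"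
proof -
  have "koszul_boundary S F u = (\<Sum>j\<in>S. (\<lambda>i. if i \<in> S then (u (i, j) - u (j, i)) * F j else 0))" for F
    by (rule ext) (simp add: koszul_boundary_def sum_apply)
  moreover have "polynomial_family tuple_scale r d
      (\<lambda>F. \<Sum>j\<in>S. (\<lambda>i. if i \<in> S then (u (i, j) - u (j, i)) * F j else 0))"
  proof (rule polynomial_family_sum)
    fix j assume "j \<in> S"
    then have "polynomial_family poly_scale r d (\<lambda>F. F j)"
      using assms by (intro polynomial_family_form) auto
    moreover have "Vector_Spaces.linear poly_scale tuple_scale
        (\<lambda>p i. if i \<in> S then (u (i, j) - u (j, i)) * p else 0)"
      by (intro linearI vector_space_poly vector_space_tuple ext)
         (simp_all add: tuple_scale_def algebra_simps)
    ultimately show "polynomial_family tuple_scale r d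
        (\<lambda>F i. if i \<in> S then (u (i, j) - u (j, i)) * F j else 0)"
      by (rule polynomial_family_linear)
  qed
  ultimately show ?thesis by simp
qed

text \<open>
  Write \<open>A\<close> and \<open>B\<close> for the differentials \<open>K\<^sub>1 \<rightarrow> R\<close> and \<open>K\<^sub>2 \<rightarrow> K\<^sub>1\<close> at \<open>F\<close>, and \<open>A\<^sub>0\<close>, \<open>B\<^sub>0\<close> for those at
  \<open>F0\<close>. Let \<open>q\<close> be a right inverse of \<open>A\<^sub>0\<close> on its image, and \<open>s\<close> one of \<open>B\<^sub>0\<close>. Then \<open>\<pi> = 1 - q A\<^sub>0\<close>
  projects \<open>K\<^sub>1\<close> onto the kernel of \<open>A\<^sub>0\<close>, which by exactness is the image of \<open>B\<^sub>0\<close>. Consequently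
  \<open>M\<^sub>1 = B s \<pi> + (1 - \<pi>)\<close> and \<open>M\<^sub>2 = \<pi> + q A\<close>, restricted to degree \<open>t\<close>, are the identity at \<open>F0\<close> and
  bijective for general \<open>F\<close>. For such \<open>F\<close> let \<open>A y = 0\<close> and write \<open>y = M\<^sub>1 w\<close>. Since \<open>A B = 0\<close>, the
  element \<open>x = (1 - \<pi>) w\<close> satisfies \<open>A x = 0\<close>, and \<open>\<pi> x = 0\<close>. So \<open>M\<^sub>2 x = 0\<close>, which gives \<open>x = 0\<close>
  and \<open>y = B s \<pi> w\<close>.
\<close>

lemma koszul_exact_open:
  fixes F0 :: "nat \<Rightarrow> ('v::finite, 'k::field) mpoly"
  assumes inf: "infinite (UNIV :: 'k set)" and S: "S \<subseteq> {..<r}"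
    and F0: "F0 \<in> form_tuples r d" and ex: "koszul_exact S d t F0"
  shows "for_general_forms r d (koszul_exact S d t :: (nat \<Rightarrow> ('v, 'k) mpoly) \<Rightarrow> bool)"
proof -
  define V1 :: "(nat \<Rightarrow> ('v, 'k) mpoly) set" where "V1 = koszul1_piece S d t"
  define V2 :: "(nat \<times> nat \<Rightarrow> ('v, 'k) mpoly) set" where "V2 = koszul2_piece S d t"
  let ?A = "relation_sum S" and ?B = "koszul_boundary S"
  have finS: "finite S" using S finite_subset by blast
  have V: "module.subspace tuple_scale V1" "module.subspace tuple_scale V2"
    unfolding V1_def V2_def by (rule subspace_graded_piece)+
  interpret W: vector_space "tuple_scale :: 'k \<Rightarrow> (nat \<Rightarrow> ('v, 'k) mpoly) \<Rightarrow> _"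
    by (rule vector_space_tuple)
  obtain q where q: "range q \<subseteq> V1" "Vector_Spaces.linear poly_scale tuple_scale q"
    "\<And>v. v \<in> ?A F0 ` V1 \<Longrightarrow> ?A F0 (q v) = v"
    using vector_space_pair.linear_exists_right_inverse_on[OF _ linear_relation_sum V(1), of S F0]
      vector_space_pair.intro[OF vector_space_tuple vector_space_poly] by metis
  obtain s where s: "range s \<subseteq> V2" "Vector_Spaces.linear tuple_scale tuple_scale s"
    "\<And>v. v \<in> ?B F0 ` V2 \<Longrightarrow> ?B F0 (s v) = v"
    using vector_space_pair.linear_exists_right_inverse_on[OF _ linear_koszul_boundary V(2), of S F0]
      vector_space_pair.intro[OF vector_space_tuple vector_space_tuple] by metis
  interpret q: Vector_Spaces.linear poly_scale tuple_scale q by (rule q(2))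
  interpret s: Vector_Spaces.linear tuple_scale tuple_scale s by (rule s(2))
  interpret A: Vector_Spaces.linear tuple_scale poly_scale "?A F" for F by (rule linear_relation_sum)
  interpret B: Vector_Spaces.linear tuple_scale tuple_scale "?B F" for F by (rule linear_koszul_boundary)
  define M1 where "M1 F v = ?B F (s (v - q (?A F0 v))) + q (?A F0 v)" for F v
  define M2 where "M2 F v = v - q (?A F0 v) + q (?A F v)" for F v
  have hom: "homogeneous (int (d i)) (F i)" if "F \<in> form_tuples r d" "i \<in> S" for F i
    using form_tuplesD[OF that(1)] S that(2) by auto
  have q_in: "q p \<in> V1" and s_in: "s y \<in> V2" for p y using q(1) s(1) by auto
  have AqA: "?A F0 (q (?A F0 v)) = ?A F0 v" if "v \<in> V1" for v using q(3) that by auto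
  have gen1: "for_general_forms r d
      (\<lambda>F. (\<forall>v\<in>V1. M1 F v = 0 \<longrightarrow> v = 0) \<and> (\<forall>v\<in>V1. \<exists>w\<in>V1. M1 F w = v))"
    unfolding V1_def
  proof (rule bijective_near_identity_graded_piece[OF finS _ _ _ F0], fold V1_def)
    show "Vector_Spaces.linear tuple_scale tuple_scale (M1 F)" for F
      by (intro linearI vector_space_tuple)
         (simp_all add: M1_def A.add q.add s.add s.diff B.add B.diff A.scale q.scale s.scale B.scale
           W.scale_right_distrib W.scale_right_diff_distrib)
    show "M1 F v \<in> V1" if "F \<in> form_tuples r d" "v \<in> V1" for F v
      unfolding M1_def
      using koszul_boundary_in_piece[of S d F, OF hom[OF that(1)]] s_in q_in V(1)
      unfolding V1_def V2_def by (intro W.subspace_add) auto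
    show "polynomial_family tuple_scale r d (\<lambda>F. M1 F v)" for v
      unfolding M1_def
      by (intro polynomial_family_add polynomial_family_koszul_boundary S polynomial_family_const)
    show "M1 F0 v = v" if v: "v \<in> V1" for v
    proof -
      have "v - q (?A F0 v) \<in> V1" using v q_in V(1) by (intro W.subspace_diff)
      moreover have "?A F0 (v - q (?A F0 v)) = 0" using AqA[OF v] by (simp add: A.diff)
      ultimately obtain u where "u \<in> V2" "?B F0 u = v - q (?A F0 v)"
        using ex unfolding koszul_exact_def V1_def V2_def by blast
      then have "v - q (?A F0 v) \<in> ?B F0 ` V2" by (metis imageI)
      then show ?thesis by (simp add: M1_def s(3))
    qed
  qed
  have gen2: "for_general_forms r d
      (\<lambda>F. (\<forall>v\<in>V1. M2 F v = 0 \<longrightarrow> v = 0) \<and> (\<forall>v\<in>V1. \<exists>w\<in>V1. M2 F w = v))"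
    unfolding V1_def
  proof (rule bijective_near_identity_graded_piece[OF finS _ _ _ F0], fold V1_def)
    show "Vector_Spaces.linear tuple_scale tuple_scale (M2 F)" for F
      by (intro linearI vector_space_tuple)
         (simp_all add: M2_def A.add q.add A.scale q.scale
           W.scale_right_distrib W.scale_right_diff_distrib)
    show "M2 F v \<in> V1" if "F \<in> form_tuples r d" "v \<in> V1" for F v
      unfolding M2_def using that(2) q_in V(1) by (intro W.subspace_add W.subspace_diff)
    show "polynomial_family tuple_scale r d (\<lambda>F. M2 F v)" for v
      unfolding M2_def
      by (intro polynomial_family_add polynomial_family_const
          polynomial_family_linear[OF polynomial_family_relation_sum[OF S] q(2)])
    show "M2 F0 v = v" for v by (simp add: M2_def)
  qed
  show ?thesis
  proof (rule for_general_forms_mono[OF for_general_forms_conj[OF inf gen1 gen2]])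
    fix F :: "nat \<Rightarrow> ('v, 'k) mpoly"
    assume "((\<forall>v\<in>V1. M1 F v = 0 \<longrightarrow> v = 0) \<and> (\<forall>v\<in>V1. \<exists>w\<in>V1. M1 F w = v)) \<and>
        (\<forall>v\<in>V1. M2 F v = 0 \<longrightarrow> v = 0) \<and> (\<forall>v\<in>V1. \<exists>w\<in>V1. M2 F w = v)"
    then have surj: "\<And>v. v \<in> V1 \<Longrightarrow> \<exists>w\<in>V1. M1 F w = v"
      and inj: "\<And>v. v \<in> V1 \<Longrightarrow> M2 F v = 0 \<Longrightarrow> v = 0" by auto
    show "koszul_exact S d t F"
      unfolding koszul_exact_def
    proof (intro ballI impI, fold V1_def V2_def)
      fix y assume y: "y \<in> V1" "?A F y = 0"
      obtain w where w: "w \<in> V1" "M1 F w = y" using surj[OF y(1)] by blast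
      have "?A F (q (?A F0 w)) = 0"
        using y(2) w(2) by (simp add: M1_def A.add relation_sum_boundary flip: w(2))
      then have "M2 F (q (?A F0 w)) = 0" by (simp add: M2_def AqA[OF w(1)])
      then have "q (?A F0 w) = 0" using inj q_in by blast
      then have "?B F (s w) = y" using w(2) by (simp add: M1_def)
      then show "\<exists>u\<in>V2. ?B F u = y" using s_in by blast
    qed
  qed
qed

text \<open>
  If \<open>q\<close> is a right inverse of the map \<open>K\<^sub>1 \<rightarrow> R\<^sub>t\<close> at \<open>F0\<close>, then the composition of \<open>q\<close> with the map
  at \<open>F\<close> is the identity of \<open>R\<^sub>t\<close> for \<open>F = F0\<close>, hence surjective for general \<open>F\<close>.
\<close>

lemma spans_degree_open:
  fixes F0 :: "nat \<Rightarrow> ('v::finite, 'k::field) mpoly"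
  assumes S: "S \<subseteq> {..<r}" and F0: "F0 \<in> form_tuples r d" and sp: "spans_degree S t F0"
  shows "for_general_forms r d (spans_degree S t :: (nat \<Rightarrow> ('v, 'k) mpoly) \<Rightarrow> bool)"
proof -
  define V1 :: "(nat \<Rightarrow> ('v, 'k) mpoly) set" where "V1 = koszul1_piece S d t"
  \<comment> \<open>\<open>R\<^sub>t\<close> as a graded piece of the free module of rank one.\<close>
  define V0 :: "(unit \<Rightarrow> ('v, 'k) mpoly) set" where "V0 = graded_piece {()} (\<lambda>_. 0) (int t)"
  define A where "A F y = (\<lambda>_::unit. relation_sum S F y)" for F :: "nat \<Rightarrow> ('v, 'k) mpoly" and y
  have V: "module.subspace tuple_scale V1" unfolding V1_def by (rule subspace_graded_piece)
  have const: "Vector_Spaces.linear poly_scale tuple_scale (\<lambda>p (_::unit). p :: ('v, 'k) mpoly)"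
    by (intro linearI vector_space_poly vector_space_tuple ext) (simp_all add: tuple_scale_def)
  have A: "Vector_Spaces.linear tuple_scale tuple_scale (A F)" for F
    using Vector_Spaces.linear_compose[OF linear_relation_sum const, of S F]
    by (simp add: A_def[abs_def] o_def)
  obtain q where q: "range q \<subseteq> V1" "Vector_Spaces.linear tuple_scale tuple_scale q"
    "\<And>v. v \<in> A F0 ` V1 \<Longrightarrow> A F0 (q v) = v"
    using vector_space_pair.linear_exists_right_inverse_on[OF _ A V, of F0]
      vector_space_pair.intro[OF vector_space_tuple vector_space_tuple] by metis
  have hom: "homogeneous (int (d i)) (F i)" if "F \<in> form_tuples r d" "i \<in> S" for F i
    using form_tuplesD[OF that(1)] S that(2) by auto
  have "for_general_forms r d (\<lambda>F. (\<forall>v\<in>V0. A F (q v) = 0 \<longrightarrow> v = 0)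
      \<and> (\<forall>v\<in>V0. \<exists>w\<in>V0. A F (q w) = v))"
    unfolding V0_def
  proof (rule bijective_near_identity_graded_piece[OF _ _ _ _ F0], fold V0_def)
    show "Vector_Spaces.linear tuple_scale tuple_scale (\<lambda>v. A F (q v))" for F
      using Vector_Spaces.linear_compose[OF q(2) A] by (simp add: o_def)
    show "A F (q v) \<in> V0" if F: "F \<in> form_tuples r d" for F v
    proof -
      have y: "q v \<in> V1" using q(1) by auto
      have "homogeneous (int t) (q v i * F i)" if "i \<in> S" for i
        using homogeneous_mult[of "int t - int (d i)" "q v i", OF _ hom[OF F that]] y that
        by (simp add: V1_def graded_piece_def)
      then show ?thesis
        by (auto simp: V0_def graded_piece_def A_def relation_sum_def intro: homogeneous_sum)
    qed
    show "polynomial_family tuple_scale r d (\<lambda>F. A F (q v))" for v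
      unfolding A_def
      by (rule polynomial_family_linear[OF polynomial_family_relation_sum[OF S] const])
    show "A F0 (q v) = v" if v: "v \<in> V0" for v
    proof (rule q(3))
      have f: "homogeneous (int t) (v ())" using v by (simp add: V0_def graded_piece_def)
      then obtain g where "relation_sum S F0 g = v ()"
        using sp unfolding spans_degree_def by (metis forms_iff_homogeneous)
      from homogeneous_coefficients[of S d F0, OF hom[OF F0] f this]
      obtain y where "y \<in> V1" "relation_sum S F0 y = v ()" unfolding V1_def by blast
      then show "v \<in> A F0 ` V1" by (intro image_eqI[of _ _ y]) (auto simp: A_def)
    qed
  qed simp
  then show ?thesis
  proof (rule for_general_forms_mono)
    fix F assume "(\<forall>v\<in>V0. A F (q v) = 0 \<longrightarrow> v = 0) \<and> (\<forall>v\<in>V0. \<exists>w\<in>V0. A F (q w) = v)"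
    then have surj: "\<And>v. v \<in> V0 \<Longrightarrow> \<exists>w. A F (q w) = v" by blast
    show "spans_degree S t F"
      unfolding spans_degree_def
    proof
      fix f :: "('v, 'k) mpoly" assume "f \<in> forms t"
      then have "(\<lambda>_. f) \<in> V0" by (simp add: V0_def graded_piece_def forms_iff_homogeneous)
      from surj[OF this] show "\<exists>y. relation_sum S F y = f" by (auto simp: A_def fun_eq_iff)
    qed
  qed
qed

lemma koszul_exact_cong:
  assumes "\<And>i. i \<in> S \<Longrightarrow> F i = G i"
  shows "koszul_exact S d t F \<longleftrightarrow> koszul_exact S d t G"
proof -
  have "relation_sum S F = relation_sum S G" "koszul_boundary S F = koszul_boundary S G"
    using assms by (auto simp: relation_sum_def koszul_boundary_def fun_eq_iff intro!: sum.cong)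
  then show ?thesis by (simp add: koszul_exact_def)
qed

text \<open>
  In a relation \<open>y\<close> among the forms indexed by \<open>insert i S\<close>, the product \<open>y i * F i\<close> lies in the ideal of
  the others, so that \<open>y i = \<Sum>j\<in>S. b j * F j\<close> by assumption. Subtracting \<open>b j\<close> times the Koszul
  relation of \<open>i\<close> and \<open>j\<close>, for all \<open>j \<in> S\<close>, removes the coefficient at \<open>i\<close> and leaves a relation
  among the forms indexed by \<open>S\<close>.
\<close>

lemma koszul_exact_insert:
  fixes F :: "nat \<Rightarrow> ('v::finite, 'k::field) mpoly"
  assumes S: "finite S" "i \<notin> S"
    and F: "\<And>j. j \<in> insert i S \<Longrightarrow> homogeneous (int (d j)) (F j)"
    and ex: "koszul_exact S d t F"
    and inj: "\<And>g h. homogeneous (int t - int (d i)) g \<Longrightarrow> g * F i = relation_sum S F h \<Longrightarrow>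
      \<exists>b. g = relation_sum S F b"
  shows "koszul_exact (insert i S) d t F"
  unfolding koszul_exact_def
proof (intro ballI impI)
  fix y :: "nat \<Rightarrow> ('v, 'k) mpoly"
  assume y: "y \<in> koszul1_piece (insert i S) d t" "relation_sum (insert i S) F y = 0"
  have y_i: "homogeneous (int t - int (d i)) (y i)" using y(1) by (simp add: graded_piece_def)
  have y_eq: "y i * F i + relation_sum S F y = 0" using y(2) S by (simp add: relation_sum_def)
  then have "y i * F i = relation_sum S F (\<lambda>j. - y j)"
    by (simp add: relation_sum_def sum_negf eq_neg_iff_add_eq_0)
  then obtain b' where "relation_sum S F b' = y i" using inj[OF y_i] by metis
  from homogeneous_coefficients[OF F[OF insertI2] y_i this]
  obtain b where b: "b \<in> graded_piece S (\<lambda>j. int (d j)) (int t - int (d i))"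
    "relation_sum S F b = y i" by blast
  let ?y = "\<lambda>j. if j \<in> S then y j + b j * F i else 0"
  have "relation_sum S F ?y = 0"
    using y_eq unfolding b(2)[symmetric]
    by (simp add: relation_sum_def sum_distrib_right sum_distrib_left sum.distrib algebra_simps)
  moreover have "?y \<in> koszul1_piece S d t"
  proof -
    have "homogeneous (int t - int (d j)) (b j * F i)" if "j \<in> S" for j
      using homogeneous_mult[of "int t - int (d i) - int (d j)" "b j" "int (d i)" "F i"] b(1) F[of i] that
      by (simp add: graded_piece_def)
    then show ?thesis using y(1) by (auto simp: graded_piece_def intro: homogeneous_add)
  qed
  ultimately obtain u where u: "u \<in> koszul2_piece S d t" "koszul_boundary S F u = ?y"
    using ex unfolding koszul_exact_def by blast
  \<comment> \<open>The row of \<open>i\<close> carries the subtracted Koszul relations. Its column is \<open>0\<close>, as only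
      differences of transposed entries count.\<close>
  define u' where "u' = (\<lambda>(j, l). if j = i then b l else if l = i then 0 else u (j, l))"
  have "u' \<in> koszul2_piece (insert i S) d t"
    using u(1) b(1) S(2) by (auto simp: graded_piece_def u'_def algebra_simps)
  moreover have "koszul_boundary (insert i S) F u' = y"
  proof
    fix j
    have bi: "b i = 0" using b(1) S(2) by (simp add: graded_piece_def)
    have "y j = (\<Sum>l\<in>S. (u (j, l) - u (l, j)) * F l) - b j * F i" if "j \<in> S"
      using fun_cong[OF u(2), of j] that by (simp add: koszul_boundary_def)
    moreover have "(\<Sum>l\<in>S. (u' (j, l) - u' (l, j)) * F l) = (\<Sum>l\<in>S. (u (j, l) - u (l, j)) * F l)"
      if "j \<in> S"
      using S(2) that by (intro sum.cong) (auto simp: u'_def)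
    moreover have "(\<Sum>l\<in>S. (u' (i, l) - u' (l, i)) * F l) = y i"
      unfolding b(2)[symmetric] relation_sum_def
      using S(2) by (intro sum.cong) (auto simp: u'_def)
    moreover have "y j = 0" if "j \<notin> insert i S" using y(1) that by (simp add: graded_piece_def)
    ultimately show "koszul_boundary (insert i S) F u' j = y j"
      using S bi by (auto simp: koszul_boundary_def u'_def)
  qed
  ultimately show "\<exists>u\<in>koszul2_piece (insert i S) d t. koszul_boundary (insert i S) F u = y" by blast
qed

section \<open>The Maximal Rank property makes the Koszul complex exact\<close>

lemma ideal_of_reindex:
  assumes h: "bij_betw h {..<s} S"
  shows "ideal_of s (\<lambda>j\<in>{..<s}. F (h j)) = range (relation_sum S F)"
proof -
  have hsum: "(\<Sum>j<s. g (h j) * F (h j)) = relation_sum S F g" for g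
    unfolding relation_sum_def by (rule sum.reindex_bij_betw[OF h])
  have inv: "(\<Sum>j<s. g j * F (h j)) = relation_sum S F (\<lambda>i. g (the_inv_into {..<s} h i))" for g
    unfolding hsum[symmetric] using h
    by (intro sum.cong refl) (simp add: bij_betw_def the_inv_into_f_f)
  show ?thesis
  proof (intro Set.set_eqI iffI)
    fix p assume "p \<in> ideal_of s (\<lambda>j\<in>{..<s}. F (h j))"
    then obtain g where "p = (\<Sum>j<s. g j * (\<lambda>j\<in>{..<s}. F (h j)) j)"
      unfolding ideal_of_def by blast
    then have "p = relation_sum S F (\<lambda>i. g (the_inv_into {..<s} h i))" using inv[of g] by simp
    then show "p \<in> range (relation_sum S F)" by blast
  next
    fix p assume "p \<in> range (relation_sum S F)"
    then obtain g where "p = relation_sum S F g" by blast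
    then have "p = (\<Sum>j<s. g (h j) * (\<lambda>j\<in>{..<s}. F (h j)) j)" using hsum[of g] by simp
    then show "p \<in> ideal_of s (\<lambda>j\<in>{..<s}. F (h j))"
      unfolding ideal_of_def by (auto intro!: exI[of _ "\<lambda>j. g (h j)"])
  qed
qed

text \<open>
  Injectivity and surjectivity of the multiplication map, stated for representatives of cosets.
\<close>

lemma maximal_rank_cases:
  fixes f :: "('v::finite, 'k::field) mpoly"
  assumes zero: "0 \<in> a" and add: "\<And>p q. p \<in> a \<Longrightarrow> q \<in> a \<Longrightarrow> p + q \<in> a"
    and mult: "\<And>p q. q \<in> a \<Longrightarrow> p * q \<in> a"
    and mr: "inj_on (quot_mult a f) (quot_piece a i) \<or>
      quot_mult a f ` quot_piece a i = quot_piece a (i + e)"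
  obtains "\<And>g. g \<in> forms i \<Longrightarrow> g * f \<in> a \<Longrightarrow> g \<in> a"
  | "\<And>g. g \<in> forms (i + e) \<Longrightarrow> \<exists>h. \<exists>p\<in>a. g = h * f + p"
proof -
  have mem: "p \<in> q +o a \<longleftrightarrow> (\<exists>b\<in>a. p = q + b)" for p q
    by (auto simp: elt_set_plus_def)
  have mult_mem: "p \<in> quot_mult a f (q +o a) \<longleftrightarrow> (\<exists>b\<in>a. p = f * q + b)" for p q
  proof
    assume "p \<in> quot_mult a f (q +o a)"
    then obtain b c where "b \<in> a" "c \<in> a" "p = f * (q + b) + c"
      by (auto simp: quot_mult_def set_plus_def elt_set_times_def mem)
    then have "p = f * q + (f * b + c)" by (simp add: algebra_simps)
    moreover have "f * b + c \<in> a" using \<open>b \<in> a\<close> \<open>c \<in> a\<close> by (intro add mult)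
    ultimately show "\<exists>b\<in>a. p = f * q + b" by blast
  next
    assume "\<exists>b\<in>a. p = f * q + b"
    then obtain b where "b \<in> a" "p = f * (q + 0) + b" by auto
    then show "p \<in> quot_mult a f (q +o a)"
      unfolding quot_mult_def set_plus_def elt_set_times_def using zero mem by blast
  qed
  from mr show ?thesis
  proof
    assume inj: "inj_on (quot_mult a f) (quot_piece a i)"
    show ?thesis
    proof (rule that(1))
      fix g assume g: "g \<in> forms i" "g * f \<in> a"
      have minus: "- b \<in> a" if "b \<in> a" for b using mult[OF that, of "-1"] by simp
      have "quot_mult a f (g +o a) = quot_mult a f (0 +o a)"
      proof (rule Set.set_eqI)
        fix p
        have "(\<exists>b\<in>a. p = f * g + b) \<longleftrightarrow> p \<in> a"
        proof
          assume "p \<in> a"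
          then have "p + - (g * f) \<in> a" using g(2) by (intro add minus)
          then show "\<exists>b\<in>a. p = f * g + b"
            by (intro bexI[of _ "p + - (g * f)"]) (auto simp: mult.commute)
        qed (use g(2) add in \<open>auto simp: mult.commute\<close>)
        then show "p \<in> quot_mult a f (g +o a) \<longleftrightarrow> p \<in> quot_mult a f (0 +o a)"
          unfolding mult_mem by auto
      qed
      then have "g +o a = 0 +o a"
        by (rule inj_onD[OF inj]) (use g(1) forms_zero in \<open>unfold quot_piece_def, blast+\<close>)
      then show "g \<in> a" using zero mem[of g g] mem[of g 0] by auto
    qed
  next
    assume surj: "quot_mult a f ` quot_piece a i = quot_piece a (i + e)"
    show ?thesis
    proof (rule that(2))
      fix g :: "('v, 'k) mpoly" assume "g \<in> forms (i + e)"
      then have "g +o a \<in> quot_piece a (i + e)" unfolding quot_piece_def by blast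
      then have "g +o a \<in> quot_mult a f ` quot_piece a i" unfolding surj .
      then obtain h where "g +o a = quot_mult a f (h +o a)" unfolding quot_piece_def by blast
      moreover have "g \<in> g +o a" using zero mem by auto
      ultimately show "\<exists>h. \<exists>p\<in>a. g = h * f + p" using mult_mem by (metis mult.commute)
    qed
  qed
qed

text \<open>
  The induction that adds the forms one at a time. The tuple \<open>F\<close> chosen in the step is general enough for
  the Koszul complex on \<open>S\<close> to be exact and for the ideal of the \<open>F j\<close>, \<open>j \<in> S\<close>, to have the Maximal
  Rank property; only then is \<open>F i\<close> replaced by a form \<open>G 0\<close> that is general with respect to this
  ideal. Surjectivity of the multiplication by \<open>G 0\<close> onto degree \<open>t\<close> is what \<open>not_spans\<close> excludes.
\<close>

lemma koszul_exact_general: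
  fixes r :: nat and d :: "nat \<Rightarrow> nat"
  assumes inf: "infinite (UNIV :: 'k::field set)"
    and pos: "\<And>i. i < r \<Longrightarrow> 1 \<le> d i"
    and mr: "\<And>(s::nat) (e :: nat \<Rightarrow> nat). s < r \<Longrightarrow> (\<And>i. i < s \<Longrightarrow> 1 \<le> e i) \<Longrightarrow>
      for_general_forms s e
        (\<lambda>F :: nat \<Rightarrow> ('v::finite, 'k) mpoly. maximal_rank_property (ideal_of s F))"
    and S: "finite S" "S \<subseteq> {i. i < r \<and> d i < t}"
    and not_spans: "\<And>F :: nat \<Rightarrow> ('v, 'k) mpoly. F \<in> form_tuples r d \<Longrightarrow>
      \<not> spans_degree {i. i < r \<and> d i < t} t F"
  shows "for_general_forms r d (koszul_exact S d t :: (nat \<Rightarrow> ('v, 'k) mpoly) \<Rightarrow> bool)"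
  using S
proof (induction S)
  case empty
  have "koszul_exact {} d t F" for F :: "nat \<Rightarrow> ('v, 'k) mpoly"
    unfolding koszul_exact_def
    by (auto simp: graded_piece_def koszul_boundary_def fun_eq_iff)
  then show ?case by (intro for_general_forms_mono[OF for_general_forms_True])
next
  case (insert i S)
  let ?s = "card S"
  have i: "i < r" "d i < t" using insert.prems by auto
  have "S \<subset> {..<r}" using insert.prems insert.hyps by auto
  then have s: "?s < r" using psubset_card_mono[of "{..<r}" S] by simp
  obtain h where h: "bij_betw h {..<?s} S"
    using ex_bij_betw_nat_finite[OF insert.hyps(1)] by (auto simp: atLeast0LessThan)
  have h': "inj_on h {..<?s}" "h ` {..<?s} \<subseteq> {..<r}"
    using h \<open>S \<subset> {..<r}\<close> by (auto simp: bij_betw_def)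
  have "for_general_forms ?s (\<lambda>j. d (h j))
      (\<lambda>F :: nat \<Rightarrow> ('v, 'k) mpoly. maximal_rank_property (ideal_of ?s F))"
    using h' by (intro mr s pos) auto
  from for_general_forms_reindex[OF h' this]
  have "for_general_forms r d (\<lambda>F. maximal_rank_property
      (range (relation_sum S F) :: ('v, 'k) mpoly set))"
    unfolding ideal_of_reindex[OF h] .
  from for_general_forms_exists[OF for_general_forms_conj[OF inf insert.IH this]]
  obtain F :: "nat \<Rightarrow> ('v, 'k) mpoly" where F: "F \<in> form_tuples r d" "koszul_exact S d t F"
    "maximal_rank_property (range (relation_sum S F))" using insert.prems by blast
  let ?a = "range (relation_sum S F)"
  have "for_general_forms 1 (\<lambda>_. d i) (\<lambda>G :: nat \<Rightarrow> ('v, 'k) mpoly. \<forall>k.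
      inj_on (quot_mult ?a (G 0)) (quot_piece ?a k) \<or>
      quot_mult ?a (G 0) ` quot_piece ?a k = quot_piece ?a (k + d i))"
    using F(3) pos[OF i(1)] unfolding maximal_rank_property_def by blast
  from for_general_forms_exists[OF this]
  obtain G :: "nat \<Rightarrow> ('v, 'k) mpoly" where G: "G \<in> form_tuples 1 (\<lambda>_. d i)"
    "\<And>k. inj_on (quot_mult ?a (G 0)) (quot_piece ?a k) \<or>
       quot_mult ?a (G 0) ` quot_piece ?a k = quot_piece ?a (k + d i)"
    by blast
  define F' where "F' = F(i := G 0)"
  have F': "F' \<in> form_tuples r d"
    using F(1) G(1) i(1) by (auto simp: F'_def form_tuples_def PiE_iff extensional_def)
  have agree: "\<And>j. j \<in> S \<Longrightarrow> F' j = F j" using insert.hyps(2) by (auto simp: F'_def)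
  then have rel: "relation_sum S F' = relation_sum S F"
    by (auto simp: relation_sum_def fun_eq_iff intro!: sum.cong)
  have ex: "koszul_exact S d t F'" by (rule iffD2[OF koszul_exact_cong F(2)]) (rule agree)
  have degree: "t - d i + d i = t" "int (t - d i) = int t - int (d i)" using i(2) by auto
  have ideal: "0 \<in> ?a" "\<And>p q. p \<in> ?a \<Longrightarrow> q \<in> ?a \<Longrightarrow> p + q \<in> ?a"
    "\<And>p q. q \<in> ?a \<Longrightarrow> p * q \<in> ?a"
  proof -
    show "0 \<in> ?a" by (rule range_eqI[of _ _ "\<lambda>_. 0"]) (simp add: relation_sum_def)
    show "p + q \<in> ?a" if pq: "p \<in> ?a" "q \<in> ?a" for p q
    proof -
      obtain g h where "p = relation_sum S F g" "q = relation_sum S F h" using pq by blast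
      then show ?thesis
        by (intro range_eqI[of _ _ "\<lambda>i. g i + h i"])
           (simp add: relation_sum_def algebra_simps sum.distrib)
    qed
    show "p * q \<in> ?a" if q: "q \<in> ?a" for p q
    proof -
      obtain g where "q = relation_sum S F g" using q by blast
      then show ?thesis
        by (intro range_eqI[of _ _ "\<lambda>i. p * g i"])
           (simp add: relation_sum_def algebra_simps sum_distrib_left)
    qed
  qed
  have "koszul_exact (insert i S) d t F'"
  proof (rule maximal_rank_cases[OF ideal G(2)[of "t - d i"]])
    assume inj: "\<And>g. g \<in> forms (t - d i) \<Longrightarrow> g * G 0 \<in> ?a \<Longrightarrow> g \<in> ?a"
    show ?thesis
    proof (rule koszul_exact_insert[OF insert.hyps(1,2) _ ex])
      show "homogeneous (int (d j)) (F' j)" if "j \<in> insert i S" for j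
        using form_tuplesD[OF F'] that insert.prems by auto
      fix g h
      assume g: "homogeneous (int t - int (d i)) g" and gF: "g * F' i = relation_sum S F' h"
      have "g * G 0 = relation_sum S F h" using gF unfolding rel by (simp add: F'_def)
      then have "g * G 0 \<in> ?a" by (simp only: rangeI)
      moreover have "g \<in> forms (t - d i)" using g unfolding forms_iff_homogeneous degree(2) .
      ultimately have "g \<in> ?a" by (rule inj[rotated])
      then show "\<exists>b. g = relation_sum S F' b" unfolding rel by blast
    qed
  next
    assume surj: "\<And>g. g \<in> forms (t - d i + d i) \<Longrightarrow> \<exists>h. \<exists>p\<in>?a. g = h * G 0 + p"
    have "spans_degree {i. i < r \<and> d i < t} t F'"
      unfolding spans_degree_def
    proof
      fix f :: "('v, 'k) mpoly" assume "f \<in> forms t"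
      then have "\<exists>h. \<exists>p\<in>?a. f = h * G 0 + p" by (intro surj) (simp only: degree)
      then obtain h p where f: "f = h * G 0 + p" "p \<in> ?a" by blast
      from f(2) obtain g where "p = relation_sum S F' g" unfolding rel by blast
      with f(1) have "f = h * F' i + (\<Sum>j\<in>S. g j * F' j)"
        by (simp add: F'_def relation_sum_def)
      moreover have "(\<Sum>j\<in>S. g j * F' j) = (\<Sum>j\<in>S. (if j = i then h else g j) * F' j)"
        using insert.hyps by (intro sum.cong) auto
      ultimately have "f = (\<Sum>j\<in>insert i S. (if j = i then h else g j) * F' j)"
        using insert.hyps by simp
      also have "\<dots> = (\<Sum>j | j < r \<and> d j < t.
          (if j = i then h else if j \<in> S then g j else 0) * F' j)"
        using insert.prems by (intro sum.mono_neutral_cong_left) auto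
      finally show "\<exists>y. relation_sum {i. i < r \<and> d i < t} F' y = f"
        by (intro exI[of _ "\<lambda>j. if j = i then h else if j \<in> S then g j else 0"])
           (simp add: relation_sum_def)
    qed
    then show ?thesis using not_spans[OF F'] by blast
  qed
  then show ?case using insert.prems by (intro koszul_exact_open[OF inf _ F']) auto
qed

lemma koszul_exact_or_spans_general:
  fixes r :: nat and d :: "nat \<Rightarrow> nat"
  assumes inf: "infinite (UNIV :: 'k::field set)"
    and pos: "\<And>i. i < r \<Longrightarrow> 1 \<le> d i"
    and mr: "\<And>(s::nat) (e :: nat \<Rightarrow> nat). s < r \<Longrightarrow> (\<And>i. i < s \<Longrightarrow> 1 \<le> e i) \<Longrightarrow>
      for_general_forms s e
        (\<lambda>F :: nat \<Rightarrow> ('v::finite, 'k) mpoly. maximal_rank_property (ideal_of s F))"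
  shows "for_general_forms r d (\<lambda>F :: nat \<Rightarrow> ('v, 'k) mpoly.
    spans_degree {i. i < r \<and> d i < t} t F \<or> koszul_exact {i. i < r \<and> d i < t} d t F)"
proof (cases "\<exists>F\<in>form_tuples r d. spans_degree {i. i < r \<and> d i < t} t (F :: nat \<Rightarrow> ('v, 'k) mpoly)")
  case True
  then obtain F0 :: "nat \<Rightarrow> ('v, 'k) mpoly" where
    F0: "F0 \<in> form_tuples r d" "spans_degree {i. i < r \<and> d i < t} t F0" by blast
  show ?thesis
    by (rule for_general_forms_mono[OF spans_degree_open[OF _ F0]]) auto
next
  case False
  have "for_general_forms r d (koszul_exact {i. i < r \<and> d i < t} d t :: (nat \<Rightarrow> ('v, 'k) mpoly) \<Rightarrow> bool)"
    using False by (intro koszul_exact_general[OF inf pos mr]) auto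
  then show ?thesis by (rule for_general_forms_mono) auto
qed

section \<open>Minimal free resolutions and the Koszul complex\<close>

text \<open>
  The constant coefficient is the value at the origin, hence multiplicative.
\<close>

lemma lookup_mult_zero:
  fixes p q :: "('x, 'k::field) mpoly"
  shows "Poly_Mapping.lookup (p * q) 0 = Poly_Mapping.lookup p 0 * Poly_Mapping.lookup q 0"
proof -
  have mono: "monomial_eval m (\<lambda>_. 0) = (if m = 0 then 1 else 0 :: 'k)" for m :: "'x \<Rightarrow>\<^sub>0 nat"
    by (auto simp: monomial_eval_def prod_zero_iff in_keys_iff power_0_left
        intro!: poly_mapping_eqI)
  have "mpoly_eval p (\<lambda>_. 0) = Poly_Mapping.lookup p 0" for p :: "('x, 'k) mpoly"
    by (simp add: mpoly_eval_superset[OF _ order_refl] mono if_distrib in_keys_iff cong: if_cong)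
  then show ?thesis by (metis mpoly_eval_mult)
qed

lemma homogeneous_0_eq_0:
  fixes p :: "('v::finite, 'k::field) mpoly"
  assumes "homogeneous 0 p" "Poly_Mapping.lookup p 0 = 0"
  shows "p = 0"
proof (rule poly_mapping_eqI)
  fix m :: "'v \<Rightarrow>\<^sub>0 nat"
  have "m = 0" if "mdeg m = 0" using that by (auto simp: mdeg_def intro: poly_mapping_eqI)
  then show "Poly_Mapping.lookup p m = Poly_Mapping.lookup 0 m"
    using assms by (cases "Poly_Mapping.lookup p m = 0") (auto simp: homogeneous_def in_keys_iff)
qed

lemma sum_antisymmetric:
  fixes f :: "nat \<Rightarrow> nat \<Rightarrow> 'a::ab_group_add"
  assumes "finite S" "\<And>i j. i \<in> S \<Longrightarrow> j \<in> S \<Longrightarrow> i \<noteq> j \<Longrightarrow> f i j = - f j i"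
  shows "(\<Sum>i\<in>S. \<Sum>j\<in>S - {i}. f i j) = 0"
  using assms
proof (induction S)
  case (insert a S)
  have IH: "(\<Sum>i\<in>S. \<Sum>j\<in>S - {i}. f i j) = 0"
    by (intro insert.IH insert.prems) auto
  have "(\<Sum>i\<in>insert a S. \<Sum>j\<in>insert a S - {i}. f i j)
      = (\<Sum>j\<in>S. f a j) + (\<Sum>i\<in>S. \<Sum>j\<in>insert a S - {i}. f i j)"
    using insert.hyps by simp
  also have "(\<Sum>i\<in>S. \<Sum>j\<in>insert a S - {i}. f i j) = (\<Sum>i\<in>S. f i a + (\<Sum>j\<in>S - {i}. f i j))"
  proof (intro sum.cong refl)
    fix i assume "i \<in> S"
    then have "insert a S - {i} = insert a (S - {i})" using insert.hyps by auto
    then show "(\<Sum>j\<in>insert a S - {i}. f i j) = f i a + (\<Sum>j\<in>S - {i}. f i j)"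
      using insert.hyps by simp
  qed
  also have "\<dots> = (\<Sum>i\<in>S. f i a)" unfolding sum.distrib IH by simp
  also have "\<dots> = (\<Sum>i\<in>S. - f a i)"
    by (intro sum.cong refl insert.prems) (use insert.hyps in auto)
  finally show ?case by (simp add: sum_negf)
qed simp

lemma sum_pairs:
  fixes f :: "nat \<Rightarrow> nat \<Rightarrow> 'a::ab_group_add"
  assumes "finite S" "\<And>i. i \<in> S \<Longrightarrow> f i i = 0"
  shows "(\<Sum>i\<in>S. \<Sum>j\<in>S. f i j)
    = (\<Sum>T | T \<subseteq> S \<and> card T = 2. f (Min T) (Max T) + f (Max T) (Min T))"
proof -
  let ?P = "{(i, j). i \<in> S \<and> j \<in> S \<and> i < j}" and ?Q = "{(i, j). i \<in> S \<and> j \<in> S \<and> j < i}"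
  let ?D = "{(i, j). i \<in> S \<and> j = i}"
  have fin: "finite ?P" "finite ?Q" "finite ?D"
    using assms(1) by (auto intro: finite_subset[of _ "S \<times> S"])
  have "S \<times> S = ?P \<union> ?Q \<union> ?D" by auto
  then have "(\<Sum>i\<in>S. \<Sum>j\<in>S. f i j) = (\<Sum>(i, j)\<in>?P \<union> ?Q \<union> ?D. f i j)"
    by (simp add: sum.cartesian_product)
  also have "\<dots> = (\<Sum>(i, j)\<in>?P. f i j) + (\<Sum>(i, j)\<in>?Q. f i j) + (\<Sum>(i, j)\<in>?D. f i j)"
    using fin by (subst sum.union_disjoint; auto)+
  also have "(\<Sum>(i, j)\<in>?D. f i j) = 0" using assms(2) by (intro sum.neutral) auto
  also have "(\<Sum>(i, j)\<in>?Q. f i j) = (\<Sum>(i, j)\<in>?P. f j i)"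
    by (rule sum.reindex_bij_witness[of _ prod.swap prod.swap]) auto
  also have "(\<Sum>(i, j)\<in>?P. f i j) + (\<Sum>(i, j)\<in>?P. f j i) + 0 = (\<Sum>(i, j)\<in>?P. f i j + f j i)"
    by (simp add: sum.distrib case_prod_unfold)
  also have "\<dots> = (\<Sum>T | T \<subseteq> S \<and> card T = 2. f (Min T) (Max T) + f (Max T) (Min T))"
  proof (rule sum.reindex_bij_witness[of _ "\<lambda>T. (Min T, Max T)" "\<lambda>(i, j). {i, j}"])
    fix T assume "T \<in> {T. T \<subseteq> S \<and> card T = 2}"
    then obtain a b where ab: "T = {a, b}" "a \<noteq> b" and "T \<subseteq> S" by (auto simp: card_2_iff)
    moreover have "\<exists>i j. T = {i, j} \<and> i < j"
    proof (cases "a < b")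
      case False
      then show ?thesis using ab by (intro exI[of _ b] exI[of _ a]) auto
    qed (use ab in blast)
    ultimately obtain i j where "T = {i, j}" "i < j" "T \<subseteq> S" by blast
    then show "(case (Min T, Max T) of (i, j) \<Rightarrow> {i, j}) = T" "(Min T, Max T) \<in> ?P" by auto
  qed auto
  finally show ?thesis .
qed

text \<open>
  The sign rule behind \<open>\<partial>\<^sup>2 = 0\<close>: if \<open>i < j\<close>, removing \<open>j\<close> does not change the position of \<open>i\<close> in \<open>S\<close>,
  while removing \<open>i\<close> lowers the position of \<open>j\<close> by one.
\<close>

lemma koszul_sign_antisymmetric:
  fixes S :: "nat set"
  assumes "finite S" "i \<in> S" "j \<in> S" "i \<noteq> j"
  shows "(-1) ^ card {l\<in>S. l < i} * (-1) ^ card {l\<in>S - {i}. l < j}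
    = - ((-1) ^ card {l\<in>S. l < j} * (-1) ^ card {l\<in>S - {j}. l < i} :: 'a::comm_ring_1)"
proof -
  have less: "(-1) ^ card {l\<in>S. l < i} * (-1) ^ card {l\<in>S - {i}. l < j}
    = - ((-1) ^ card {l\<in>S. l < j} * (-1) ^ card {l\<in>S - {j}. l < i} :: 'a)"
    if "i \<in> S" "i < j" for i j
  proof -
    have "{l\<in>S - {j}. l < i} = {l\<in>S. l < i}" using that by auto
    moreover have "{l\<in>S. l < j} = insert i {l\<in>S - {i}. l < j}" using that by auto
    then have "card {l\<in>S. l < j} = Suc (card {l\<in>S - {i}. l < j})" using assms(1) by simp
    ultimately show ?thesis by simp
  qed
  show ?thesis
    using less[of i j] less[of j i] assms by (cases "i < j") (auto simp: mult.commute)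
qed

text \<open>
  The vectors and matrices of a resolution are handled below as functions of the indices, so that
  the linear algebra becomes a calculation with finite sums.
\<close>

locale resolution_of_forms =
  fixes r :: nat and d :: "nat \<Rightarrow> nat" and F :: "nat \<Rightarrow> ('v::finite, 'k::field) mpoly"
    and sh :: "nat \<Rightarrow> int list" and \<phi> :: "nat \<Rightarrow> ('v, 'k) mpoly mat"
  assumes form: "\<And>i. i < r \<Longrightarrow> homogeneous (int (d i)) (F i)"
    and res: "minimal_graded_free_resolution (ideal_of r F) sh \<phi>"
begin

abbreviation rank :: "nat \<Rightarrow> nat" where "rank i \<equiv> length (sh i)"

text \<open>
  The differential \<open>\<bbbF>\<^sub>i \<rightarrow> \<bbbF>\<^sub>i\<^sub>-\<^sub>1\<close> in coordinates.
\<close>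

definition bd :: "nat \<Rightarrow> (nat \<Rightarrow> ('v, 'k) mpoly) \<Rightarrow> nat \<Rightarrow> ('v, 'k) mpoly" where
  "bd i v p = (\<Sum>q<rank i. \<phi> i $$ (p, q) * v q)"

lemma sh_0: "sh 0 = [0]"
  using res unfolding minimal_graded_free_resolution_def by blast

lemma \<phi>_carrier: "1 \<le> i \<Longrightarrow> \<phi> i \<in> carrier_mat (rank (i - 1)) (rank i)"
  using res unfolding minimal_graded_free_resolution_def by blast

lemma entry_homogeneous:
  assumes "1 \<le> i" "p < rank (i - 1)" "q < rank i"
  shows "homogeneous (sh i ! q - sh (i - 1) ! p) (\<phi> i $$ (p, q))"
proof -
  have "col (\<phi> i) q \<in> free_piece (sh (i - 1)) (sh i ! q)"
    using res assms unfolding minimal_graded_free_resolution_def by blast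
  then have "\<forall>m\<in>Poly_Mapping.keys (col (\<phi> i) q $ p). int (mdeg m) + sh (i - 1) ! p = sh i ! q"
    using assms(2) unfolding free_piece_def by blast
  moreover have "col (\<phi> i) q $ p = \<phi> i $$ (p, q)"
    using \<phi>_carrier[OF assms(1)] assms by simp
  ultimately show ?thesis by (auto simp: homogeneous_def eq_diff_eq)
qed

lemma entry_minimal:
  "1 \<le> i \<Longrightarrow> p < rank (i - 1) \<Longrightarrow> q < rank i \<Longrightarrow> Poly_Mapping.lookup (\<phi> i $$ (p, q)) 0 = 0"
  using res unfolding minimal_graded_free_resolution_def by blast

lemma mult_vec_eq_bd:
  assumes "1 \<le> i" "v \<in> carrier_vec (rank i)" "p < rank (i - 1)"
  shows "(\<phi> i *\<^sub>v v) $ p = bd i (\<lambda>q. v $ q) p"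
  using \<phi>_carrier[OF assms(1)] assms(2,3)
  by (auto simp: bd_def scalar_prod_def atLeast0LessThan)

lemma mult_vec_vec:
  assumes "1 \<le> i"
  shows "\<phi> i *\<^sub>v vec (rank i) f = vec (rank (i - 1)) (bd i f)"
proof (rule eq_vecI)
  fix p assume "p < dim_vec (vec (rank (i - 1)) (bd i f))"
  then show "(\<phi> i *\<^sub>v vec (rank i) f) $ p = vec (rank (i - 1)) (bd i f) $ p"
    using mult_vec_eq_bd[OF assms, of "vec (rank i) f" p] by (simp add: bd_def)
qed (use \<phi>_carrier[OF assms] in auto)

lemma bd_diff: "bd i (\<lambda>q. v q - w q) p = bd i v p - bd i w p"
  by (simp add: bd_def algebra_simps sum_subtractf)

lemma bd_scale: "bd i (\<lambda>q. f * v q) p = f * bd i v p"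
  by (simp add: bd_def algebra_simps sum_distrib_left)

lemma bd_sum: "bd i (\<lambda>q. \<Sum>x\<in>A. v x q) p = (\<Sum>x\<in>A. bd i (v x) p)"
  by (simp add: bd_def sum_distrib_left) (rule sum.swap)

lemma bd_basis: "q < rank i \<Longrightarrow> bd i (\<lambda>l. if l = q then 1 else 0) p = \<phi> i $$ (p, q)"
  by (simp add: bd_def if_distrib cong: if_cong)

lemma bd_exact:
  assumes "1 \<le> i" "\<And>p. p < rank (i - 1) \<Longrightarrow> bd i v p = 0"
  obtains w where "\<And>q. q < rank i \<Longrightarrow> v q = bd (i + 1) w q"
proof -
  have "\<phi> i *\<^sub>v vec (rank i) v = 0\<^sub>v (rank (i - 1))"
    unfolding mult_vec_vec[OF assms(1)] by (rule eq_vecI) (auto simp: assms(2))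
  then have "vec (rank i) v \<in> mat_kernel (\<phi> i)"
    by (intro mat_kernelI[OF \<phi>_carrier[OF assms(1)]]) auto
  also have "mat_kernel (\<phi> i) = {\<phi> (i + 1) *\<^sub>v w | w. w \<in> carrier_vec (rank (i + 1))}"
    using res assms(1) unfolding minimal_graded_free_resolution_def by blast
  finally obtain w where w: "w \<in> carrier_vec (rank (i + 1))" "vec (rank i) v = \<phi> (i + 1) *\<^sub>v w"
    by blast
  show thesis
  proof (rule that)
    fix q assume "q < rank i"
    then show "v q = bd (i + 1) (\<lambda>l. w $ l) q"
      using mult_vec_eq_bd[of "i + 1" w q] w by (metis add_diff_cancel_right' index_vec le_add2)
  qed
qed

lemma bd_bd:
  assumes "1 \<le> i" "p < rank (i - 1)"
  shows "bd i (bd (i + 1) w) p = 0"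
proof -
  have "mat_kernel (\<phi> i) = {\<phi> (i + 1) *\<^sub>v w | w. w \<in> carrier_vec (rank (i + 1))}"
    using res assms(1) unfolding minimal_graded_free_resolution_def by blast
  moreover have "\<phi> (i + 1) *\<^sub>v vec (rank (i + 1)) w = vec (rank i) (bd (i + 1) w)"
    using mult_vec_vec[of "i + 1" w] by simp
  ultimately have "vec (rank i) (bd (i + 1) w) \<in> mat_kernel (\<phi> i)"
    using vec_carrier by (metis (mono_tags, lifting) mem_Collect_eq)
  then have "\<phi> i *\<^sub>v vec (rank i) (bd (i + 1) w) = 0\<^sub>v (rank (i - 1))"
    using \<phi>_carrier[OF assms(1)] by (auto simp: mat_kernel_def)
  then show ?thesis
    unfolding mult_vec_vec[OF assms(1)] using assms(2) by (metis index_vec index_zero_vec(1))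
qed

lemma bd_ideal: "f \<in> ideal_of r F \<longleftrightarrow> (\<exists>v. f = bd 1 v 0)"
proof -
  have I: "{(\<phi> 1 *\<^sub>v v) $ 0 | v. v \<in> carrier_vec (rank 1)} = ideal_of r F"
    using res unfolding minimal_graded_free_resolution_def by blast
  have r0: "0 < rank (1 - 1)" using sh_0 by simp
  show ?thesis
  proof
    assume "f \<in> ideal_of r F"
    then obtain v where "v \<in> carrier_vec (rank 1)" "f = (\<phi> 1 *\<^sub>v v) $ 0" using I by blast
    then show "\<exists>v. f = bd 1 v 0" using mult_vec_eq_bd[OF order_refl _ r0] by blast
  next
    assume "\<exists>v. f = bd 1 v 0"
    then obtain v where "f = bd 1 v 0" by blast
    then have "f = (\<phi> 1 *\<^sub>v vec (rank 1) v) $ 0"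
      unfolding mult_vec_vec[OF order_refl] using r0 by simp
    then show "f \<in> ideal_of r F" using I vec_carrier by blast
  qed
qed

lemma bd_minimal:
  assumes "1 \<le> i" "p < rank (i - 1)"
  shows "Poly_Mapping.lookup (bd i v p) 0 = 0"
  using entry_minimal[OF assms] by (simp add: bd_def lookup_sum lookup_mult_zero)

lemma bd_homogeneous_part:
  assumes "1 \<le> i" "p < rank (i - 1)"
  shows "bd i (\<lambda>q. homogeneous_part (t - sh i ! q) (v q)) p
    = homogeneous_part (t - sh (i - 1) ! p) (bd i v p)"
  unfolding bd_def homogeneous_part_sum
proof (intro sum.cong refl)
  fix q assume "q \<in> {..<rank i}"
  then show "\<phi> i $$ (p, q) * homogeneous_part (t - sh i ! q) (v q)
      = homogeneous_part (t - sh (i - 1) ! p) (\<phi> i $$ (p, q) * v q)"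
    using homogeneous_part_mult[OF entry_homogeneous[OF assms], of q "t - sh i ! q" "v q"]
    by (simp add: algebra_simps)
qed

text \<open>
  The differentials preserve degrees, so the part of degree \<open>t\<close> of a preimage is again a preimage.
\<close>

lemma homogeneous_preimage:
  assumes "1 \<le> i" "\<And>p. p < rank (i - 1) \<Longrightarrow> homogeneous (t - sh (i - 1) ! p) (z p)"
    "\<And>p. p < rank (i - 1) \<Longrightarrow> z p = bd i v p"
  obtains w where "\<And>q. homogeneous (t - sh i ! q) (w q)"
    "\<And>p. p < rank (i - 1) \<Longrightarrow> bd i w p = z p"
proof (rule that)
  let ?w = "\<lambda>q. homogeneous_part (t - sh i ! q) (v q)"
  show "homogeneous (t - sh i ! q) (?w q)" for q by (rule homogeneous_homogeneous_part)
  show "bd i ?w p = z p" if "p < rank (i - 1)" for p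
    using bd_homogeneous_part[OF assms(1) that, of t v] assms(2,3)[OF that]
      homogeneous_part_id by metis
qed

text \<open>
  The image of \<open>\<partial> e\<^sub>S\<close> under the chain map with values \<open>k\<close>; it is what the differential
  of \<open>\<bbbF>\<close> has to map \<open>k S\<close> to.
\<close>

definition koszul_rhs :: "(nat set \<Rightarrow> nat \<Rightarrow> ('v, 'k) mpoly) \<Rightarrow> nat set \<Rightarrow> nat \<Rightarrow> ('v, 'k) mpoly" where
  "koszul_rhs k S p = (\<Sum>i\<in>S. (-1) ^ card {j\<in>S. j < i} * F i * k (S - {i}) p)"

definition comparison_at :: "(nat set \<Rightarrow> nat \<Rightarrow> ('v, 'k) mpoly) \<Rightarrow> nat set \<Rightarrow> bool" where
  "comparison_at k S \<longleftrightarrow>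
     (\<forall>q<rank (card S). homogeneous (int (\<Sum>i\<in>S. d i) - sh (card S) ! q) (k S q)) \<and>
     (S \<noteq> {} \<longrightarrow> (\<forall>p<rank (card S - 1). bd (card S) (k S) p = koszul_rhs k S p))"

text \<open>
  The chain map condition in lower degrees turns the differential of this element into the image
  of \<open>\<partial> (\<partial> e\<^sub>S)\<close>, a double sum whose terms cancel in pairs.
\<close>

lemma koszul_rhs_cycle:
  assumes S: "S \<subseteq> {..<r}" "card S = Suc n" "1 \<le> n"
    and k: "\<And>S. S \<subseteq> {..<r} \<Longrightarrow> card S = n \<Longrightarrow> comparison_at k S" and p: "p < rank (n - 1)"
  shows "bd n (koszul_rhs k S) p = 0"
proof -
  let ?e = "\<lambda>S i. (-1) ^ card {j\<in>S. j < i} :: ('v, 'k) mpoly"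
  have fin: "finite S" using S(1) finite_subset by blast
  have "bd n (koszul_rhs k S) p = (\<Sum>i\<in>S. ?e S i * F i * bd n (k (S - {i})) p)"
    unfolding koszul_rhs_def by (simp add: bd_sum bd_scale)
  also have "\<dots> = (\<Sum>i\<in>S. ?e S i * F i * koszul_rhs k (S - {i}) p)"
  proof (intro sum.cong refl)
    fix i assume "i \<in> S"
    then have "card (S - {i}) = n" "S - {i} \<subseteq> {..<r}" using S fin by auto
    moreover from this(1) have "S - {i} \<noteq> {}" using S(3) by force
    ultimately show "?e S i * F i * bd n (k (S - {i})) p = ?e S i * F i * koszul_rhs k (S - {i}) p"
      using k[of "S - {i}"] p by (simp add: comparison_at_def)
  qed
  also have "\<dots> = (\<Sum>i\<in>S. \<Sum>j\<in>S - {i}.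
      (?e S i * ?e (S - {i}) j) * (F i * F j * k (S - {i} - {j}) p))"
    unfolding koszul_rhs_def sum_distrib_left by (simp add: mult_ac)
  also have "\<dots> = 0"
  proof (rule sum_antisymmetric[OF fin])
    fix i j assume ij: "i \<in> S" "j \<in> S" "i \<noteq> j"
    have "S - {i} - {j} = S - {j} - {i}" by auto
    then show "(?e S i * ?e (S - {i}) j) * (F i * F j * k (S - {i} - {j}) p)
      = - ((?e S j * ?e (S - {j}) i) * (F j * F i * k (S - {j} - {i}) p))"
      unfolding koszul_sign_antisymmetric[OF fin ij] by (simp add: mult_ac)
  qed
  finally show ?thesis .
qed

lemma koszul_rhs_homogeneous:
  assumes S: "S \<subseteq> {..<r}" "card S = Suc n"
    and k: "\<And>S. S \<subseteq> {..<r} \<Longrightarrow> card S = n \<Longrightarrow> comparison_at k S" and p: "p < rank n"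
  shows "homogeneous (int (\<Sum>i\<in>S. d i) - sh n ! p) (koszul_rhs k S p)"
  unfolding koszul_rhs_def
proof (rule homogeneous_sum)
  fix i assume i: "i \<in> S"
  have fin: "finite S" using S(1) finite_subset by blast
  have "card (S - {i}) = n" "S - {i} \<subseteq> {..<r}" using S fin i by auto
  then have hom: "homogeneous (int (\<Sum>i\<in>S - {i}. d i) - sh n ! p) (k (S - {i}) p)"
    using k p unfolding comparison_at_def by blast
  have "homogeneous 0 (Poly_Mapping.single 0 1 :: ('v, 'k) mpoly)" by (rule homogeneous_const)
  then have "homogeneous 0 ((-1) ^ m :: ('v, 'k) mpoly)" for m
    by (cases "even m") (simp_all add: homogeneous_uminus)
  moreover have "int (\<Sum>i\<in>S. d i) - sh n ! p
      = 0 + int (d i) + (int (\<Sum>i\<in>S - {i}. d i) - sh n ! p)"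
    using sum.remove[OF fin i, of d] by simp
  moreover have "i < r" using i S(1) by auto
  ultimately show "homogeneous (int (\<Sum>i\<in>S. d i) - sh n ! p)
      ((-1) ^ card {j\<in>S. j < i} * F i * k (S - {i}) p)"
    by (metis homogeneous_mult form hom)
qed

text \<open>
  The standard lifting argument: the right hand side required for \<open>k S\<close> is a cycle, by exactness of the
  resolution a boundary, and hence the differential of a homogeneous element of the right degree. For
  \<open>S = {i}\<close> it is \<open>F i\<close> itself, which is in the image of \<open>\<bbbF>\<^sub>1\<close> because it lies in the ideal.
\<close>

lemma comparison_up_to:
  "\<exists>k. k {} = (\<lambda>_. 1) \<and> (\<forall>S\<subseteq>{..<r}. card S \<le> n \<longrightarrow> comparison_at k S)"
proof (induction n)
  case 0
  show ?case
  proof (intro exI[of _ "\<lambda>_ _. 1"] conjI allI impI)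
    fix S assume "S \<subseteq> {..<r}" "card S \<le> 0"
    then have "S = {}" using finite_subset by fastforce
    then show "comparison_at (\<lambda>_ _. 1) S"
      using homogeneous_const[of "1 :: 'k"] by (simp add: comparison_at_def sh_0)
  qed simp
next
  case (Suc n)
  then obtain k where k: "k {} = (\<lambda>_. 1)" "\<And>S. S \<subseteq> {..<r} \<Longrightarrow> card S \<le> n \<Longrightarrow> comparison_at k S"
    by blast
  have "\<exists>w. (\<forall>q. homogeneous (int (\<Sum>i\<in>S. d i) - sh (Suc n) ! q) (w q)) \<and>
      (\<forall>p<rank n. bd (Suc n) w p = koszul_rhs k S p)"
    if S: "S \<subseteq> {..<r}" "card S = Suc n" for S
  proof -
    have hom: "homogeneous (int (\<Sum>i\<in>S. d i) - sh n ! p) (koszul_rhs k S p)" if "p < rank n" for p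
      using koszul_rhs_homogeneous[OF S _ that] k(2) by auto
    have "\<exists>v. \<forall>p<rank n. koszul_rhs k S p = bd (Suc n) v p"
    proof (cases "n = 0")
      case True
      then obtain i where i: "S = {i}" using S(2) by (auto simp: card_1_singleton_iff)
      have empty: "{j. j = i \<and> j < i} = {}" by auto
      have rhs: "koszul_rhs k S p = F i" for p
        unfolding koszul_rhs_def using k(1) i by (simp add: empty)
      have "F i = (\<Sum>j<r. (if j = i then 1 else 0) * F j)"
        using i S(1) by (simp add: if_distrib[of "\<lambda>x. x * _"] cong: if_cong)
      then have "F i \<in> ideal_of r F"
        unfolding ideal_of_def by (intro CollectI exI[of _ "\<lambda>j. if j = i then 1 else 0"]) simp
      then obtain v where "F i = bd 1 v 0" using bd_ideal by blast
      then show ?thesis using True rhs by (intro exI[of _ v]) (auto simp: sh_0)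
    next
      case False
      then have "bd n (koszul_rhs k S) p = 0" if "p < rank (n - 1)" for p
        using koszul_rhs_cycle[OF S _ _ that] k(2) by auto
      from bd_exact[OF _ this] False
      obtain v where "\<And>q. q < rank n \<Longrightarrow> koszul_rhs k S q = bd (n + 1) v q" by auto
      then show ?thesis by auto
    qed
    then obtain v where "\<And>p. p < rank n \<Longrightarrow> koszul_rhs k S p = bd (Suc n) v p" by blast
    then show ?thesis
      using homogeneous_preimage[of "Suc n" "int (\<Sum>i\<in>S. d i)" "koszul_rhs k S" v] hom
      by (metis Suc_eq_plus1 add_diff_cancel_right' le_add2)
  qed
  then obtain w where w: "\<And>S q. S \<subseteq> {..<r} \<Longrightarrow> card S = Suc n \<Longrightarrow>
      homogeneous (int (\<Sum>i\<in>S. d i) - sh (Suc n) ! q) (w S q)"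
    "\<And>S p. S \<subseteq> {..<r} \<Longrightarrow> card S = Suc n \<Longrightarrow> p < rank n \<Longrightarrow>
      bd (Suc n) (w S) p = koszul_rhs k S p" by metis
  define k' where "k' S = (if card S = Suc n then w S else k S)" for S
  have "comparison_at k' S" if S: "S \<subseteq> {..<r}" "card S \<le> Suc n" for S
  proof -
    have fin: "finite S" using S(1) finite_subset by blast
    have rhs: "koszul_rhs k' S = koszul_rhs k S"
    proof
      fix p
      have "card (S - {i}) \<noteq> Suc n" if "i \<in> S" for i
        using card_Diff1_less[OF fin that] S(2) by simp
      then show "koszul_rhs k' S p = koszul_rhs k S p"
        unfolding koszul_rhs_def k'_def by (intro sum.cong) auto
    qed
    show ?thesis
    proof (cases "card S = Suc n")
      case True
      then show ?thesis using w[OF S(1) True] unfolding comparison_at_def rhs by (simp add: k'_def)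
    next
      case False
      then show ?thesis using k(2)[OF S(1)] S(2) unfolding comparison_at_def rhs by (simp add: k'_def)
    qed
  qed
  moreover have "k' {} = (\<lambda>_. 1)" using k(1) by (simp add: k'_def)
  ultimately show ?case by blast
qed

lemma koszul_comparison_exists: "\<exists>\<kappa>. koszul_comparison r d F sh \<phi> \<kappa>"
proof -
  obtain k where k: "k {} = (\<lambda>_. 1)" "\<And>S. S \<subseteq> {..<r} \<Longrightarrow> card S \<le> r \<Longrightarrow> comparison_at k S"
    using comparison_up_to[of r] by blast
  define \<kappa> where "\<kappa> S = vec (rank (card S)) (k S)" for S
  have "koszul_comparison r d F sh \<phi> \<kappa>"
    unfolding koszul_comparison_def
  proof (intro conjI allI impI)
    show "\<kappa> {} = vec 1 (\<lambda>_. 1)" by (simp add: \<kappa>_def k(1) sh_0)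
  next
    fix S assume S: "S \<subseteq> {..<r}"
    then have fin: "finite S" and "card S \<le> r"
      using finite_subset card_mono[of "{..<r}" S] by auto
    then have at: "comparison_at k S" using k(2) S by blast
    then show "\<kappa> S \<in> free_piece (sh (card S)) (int (\<Sum>i\<in>S. d i))"
      by (force simp: free_piece_def \<kappa>_def comparison_at_def homogeneous_def)
    assume ne: "S \<noteq> {}"
    then have card: "1 \<le> card S" using fin by (simp add: Suc_le_eq card_gt_0_iff)
    show "\<phi> (card S) *\<^sub>v \<kappa> S = vec (rank (card S - 1))
        (\<lambda>q. \<Sum>i\<in>S. (-1) ^ card {j\<in>S. j < i} * F i * (\<kappa> (S - {i}) $ q))"
      unfolding \<kappa>_def mult_vec_vec[OF card]
    proof (rule eq_vecI)
      fix q
      assume "q < dim_vec (vec (rank (card S - 1)) (\<lambda>q. \<Sum>i\<in>S.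
        (-1) ^ card {j\<in>S. j < i} * F i * (vec (rank (card (S - {i}))) (k (S - {i})) $ q)))"
      then have q: "q < rank (card S - 1)" by simp
      have "koszul_rhs k S q = (\<Sum>i\<in>S. (-1) ^ card {j\<in>S. j < i} * F i
          * (vec (rank (card (S - {i}))) (k (S - {i})) $ q))"
        unfolding koszul_rhs_def using q fin by (intro sum.cong) auto
      then show "vec (rank (card S - 1)) (bd (card S) (k S)) $ q
        = vec (rank (card S - 1)) (\<lambda>q. \<Sum>i\<in>S. (-1) ^ card {j\<in>S. j < i} * F i
          * (vec (rank (card (S - {i}))) (k (S - {i})) $ q)) $ q"
        using at ne q by (simp add: comparison_at_def)
    qed simp
  qed
  then show ?thesis by blast
qed

lemma comparison_at_vec:
  assumes \<kappa>: "koszul_comparison r d F sh \<phi> \<kappa>" and S: "S \<subseteq> {..<r}"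
  shows "comparison_at (\<lambda>S q. \<kappa> S $ q) S"
proof -
  have mem: "\<kappa> S \<in> free_piece (sh (card S)) (int (\<Sum>i\<in>S. d i))"
    using \<kappa> S unfolding koszul_comparison_def by blast
  have "bd (card S) (\<lambda>q. \<kappa> S $ q) p = koszul_rhs (\<lambda>S q. \<kappa> S $ q) S p"
    if "S \<noteq> {}" and p: "p < rank (card S - 1)" for p
  proof -
    have "finite S" using S finite_subset by blast
    then have card: "1 \<le> card S" using \<open>S \<noteq> {}\<close> by (simp add: Suc_le_eq card_gt_0_iff)
    have "\<phi> (card S) *\<^sub>v \<kappa> S = vec (rank (card S - 1)) (koszul_rhs (\<lambda>S q. \<kappa> S $ q) S)"
      using \<kappa> S \<open>S \<noteq> {}\<close> unfolding koszul_comparison_def koszul_rhs_def by blast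
    moreover have "\<kappa> S \<in> carrier_vec (rank (card S))" using mem by (simp add: free_piece_def)
    ultimately show ?thesis using mult_vec_eq_bd[OF card _ p] p by (metis index_vec)
  qed
  then show ?thesis
    using mem by (auto simp: comparison_at_def free_piece_def homogeneous_def eq_diff_eq)
qed

section \<open>Ghost terms\<close>

lemma generator_coefficients:
  assumes "q < rank 1"
  obtains a where "a \<in> graded_piece {..<r} (\<lambda>i. int (d i)) (sh 1 ! q)"
    "relation_sum {..<r} F a = \<phi> 1 $$ (0, q)"
proof -
  have "\<phi> 1 $$ (0, q) \<in> ideal_of r F"
    using bd_basis[OF assms, of 0] bd_ideal by metis
  then obtain g where "relation_sum {..<r} F g = \<phi> 1 $$ (0, q)"
    by (auto simp: ideal_of_def relation_sum_def)
  moreover have "homogeneous (sh 1 ! q) (\<phi> 1 $$ (0, q))"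
    using entry_homogeneous[of 1 0 q] assms by (simp add: sh_0)
  ultimately show thesis
    using homogeneous_coefficients[of "{..<r}" d F "sh 1 ! q" "\<phi> 1 $$ (0, q)" g] form that
    by auto
qed

lemma comparison_singleton:
  assumes "koszul_comparison r d F sh \<phi> \<kappa>" "i < r"
  shows "bd 1 (\<lambda>q. \<kappa> {i} $ q) 0 = F i"
    "q < rank 1 \<Longrightarrow> homogeneous (int (d i) - sh 1 ! q) (\<kappa> {i} $ q)"
proof -
  have "comparison_at (\<lambda>S q. \<kappa> S $ q) {i}"
    by (rule comparison_at_vec[OF assms(1)]) (use assms(2) in auto)
  moreover have "\<kappa> {} = vec 1 (\<lambda>_. 1)" using assms(1) unfolding koszul_comparison_def by blast
  moreover have empty: "{j. j = i \<and> j < i} = {}" by auto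
  ultimately show "bd 1 (\<lambda>q. \<kappa> {i} $ q) 0 = F i"
    "q < rank 1 \<Longrightarrow> homogeneous (int (d i) - sh 1 ! q) (\<kappa> {i} $ q)"
    by (simp_all add: comparison_at_def koszul_rhs_def sh_0 empty)
qed

lemma comparison_pair:
  assumes "koszul_comparison r d F sh \<phi> \<kappa>" "i < j" "j < r" "p < rank 1"
  shows "bd 2 (\<lambda>q. \<kappa> {i, j} $ q) p = F i * \<kappa> {j} $ p - F j * \<kappa> {i} $ p"
proof -
  have "comparison_at (\<lambda>S q. \<kappa> S $ q) {i, j}"
    by (rule comparison_at_vec[OF assms(1)]) (use assms in auto)
  moreover have "{l. (l = i \<or> l = j) \<and> l < i} = {}" "{l. (l = i \<or> l = j) \<and> l < j} = {i}"
    "{i, j} - {i} = {j}" "{i, j} - {j} = {i}"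
    using assms(2) by auto
  ultimately show ?thesis
    using assms(2,4) by (simp add: comparison_at_def koszul_rhs_def numeral_2_eq_2)
qed

text \<open>
  A minimal generator is not redundant. If it is written as \<open>\<Sum>i\<in>X. a i * F i\<close>, replacing each \<open>F i\<close> by its
  own expression through the generators gives an element of the kernel of \<open>\<bbbF>\<^sub>1 \<rightarrow> R\<close>, all of whose
  entries have constant coefficient \<open>0\<close>. At the index \<open>q\<close> this requires that some \<open>a i\<close> have
  a nonzero constant coefficient, that is, degree \<open>0\<close>.
\<close>

lemma minimal_generator_degree:
  assumes q: "q < rank 1" and X: "X \<subseteq> {..<r}"
    and a: "a \<in> graded_piece X (\<lambda>i. int (d i)) (sh 1 ! q)"
    and eq: "relation_sum X F a = \<phi> 1 $$ (0, q)"
  shows "\<exists>i\<in>X. int (d i) = sh 1 ! q"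
proof -
  obtain \<kappa> where \<kappa>: "koszul_comparison r d F sh \<phi> \<kappa>" using koszul_comparison_exists by blast
  define v where "v l = (if l = q then 1 else 0) - (\<Sum>i\<in>X. a i * \<kappa> {i} $ l)" for l
  have "bd 1 v 0 = \<phi> 1 $$ (0, q) - (\<Sum>i\<in>X. a i * bd 1 (\<lambda>l. \<kappa> {i} $ l) 0)"
    unfolding v_def bd_diff bd_sum bd_scale bd_basis[OF q] ..
  also have "(\<Sum>i\<in>X. a i * bd 1 (\<lambda>l. \<kappa> {i} $ l) 0) = relation_sum X F a"
    unfolding relation_sum_def using X comparison_singleton(1)[OF \<kappa>] by (intro sum.cong) auto
  finally have "bd 1 v p = 0" if "p < rank (1 - 1)" for p using that eq by (simp add: sh_0)
  from bd_exact[OF order_refl this]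
  obtain w where "\<And>l. l < rank 1 \<Longrightarrow> v l = bd 2 w l" by (auto simp: numeral_2_eq_2)
  then have "Poly_Mapping.lookup (v q) 0 = 0" using bd_minimal[of 2 q w] q by simp
  then have "(\<Sum>i\<in>X. Poly_Mapping.lookup (a i) 0 * Poly_Mapping.lookup (\<kappa> {i} $ q) 0) \<noteq> 0"
    by (simp add: v_def lookup_minus lookup_sum lookup_mult_zero)
  then obtain i where i: "i \<in> X" "Poly_Mapping.lookup (a i) 0 \<noteq> 0"
    by (metis (no_types, lifting) mult_zero_left sum.neutral)
  have "homogeneous (sh 1 ! q - int (d i)) (a i)" using a i(1) by (simp add: graded_piece_def)
  then have "sh 1 ! q - int (d i) = 0" using i(2) by (rule homogeneous_lookup_zero)
  then show ?thesis using i(1) by auto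
qed

text \<open>
  Both claims come from \<open>minimal_generator_degree\<close>. Applied to all the forms it yields one of degree \<open>t\<close>;
  applied to the forms of smaller degree it would yield one of degree \<open>t\<close> among them, so
  they cannot generate the minimal generator.
\<close>

lemma generator_degree:
  assumes "t \<in> set (sh 1)"
  obtains T where "t = int T" "T \<in> d ` {..<r}" "\<not> spans_degree {i. i < r \<and> d i < T} T F"
proof -
  obtain q where q: "q < rank 1" "sh 1 ! q = t" using assms by (auto simp: in_set_conv_nth)
  obtain a where a: "a \<in> graded_piece {..<r} (\<lambda>i. int (d i)) (sh 1 ! q)"
    "relation_sum {..<r} F a = \<phi> 1 $$ (0, q)" using generator_coefficients[OF q(1)] .
  obtain i where i: "i < r" "int (d i) = t"
    using minimal_generator_degree[OF q(1) order_refl a] q(2) by auto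
  let ?X = "{j. j < r \<and> d j < d i}"
  have "\<not> spans_degree ?X (d i) F"
  proof
    assume sp: "spans_degree ?X (d i) F"
    have hom: "homogeneous (sh 1 ! q) (\<phi> 1 $$ (0, q))"
      using entry_homogeneous[of 1 0 q] q(1) by (simp add: sh_0)
    then have "\<phi> 1 $$ (0, q) \<in> forms (d i)" using q(2) i(2) by (simp add: forms_iff_homogeneous)
    then obtain g where "relation_sum ?X F g = \<phi> 1 $$ (0, q)"
      using sp unfolding spans_degree_def by blast
    with hom obtain b where "b \<in> graded_piece ?X (\<lambda>i. int (d i)) (sh 1 ! q)"
      "relation_sum ?X F b = \<phi> 1 $$ (0, q)"
      using homogeneous_coefficients[of ?X d F "sh 1 ! q" "\<phi> 1 $$ (0, q)" g] form by auto
    then have "\<exists>j\<in>?X. int (d j) = sh 1 ! q" by (intro minimal_generator_degree[OF q(1)]) auto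
    then show False using q(2) i(2) by auto
  qed
  then show thesis using that[of "d i"] i by auto
qed

lemma koszul_fibre_map_into:
  assumes \<kappa>: "koszul_comparison r d F sh \<phi> \<kappa>" and c: "c \<in> koszul2_fibre_piece r d t"
  shows "koszul2_fibre_map r (sh 2) \<kappa> c \<in> fibre_piece (sh 2) t"
proof -
  have "sh 2 ! q = t" if q: "q < rank 2"
    and ne: "(\<Sum>S | S \<subseteq> {..<r} \<and> card S = 2. c S * Poly_Mapping.lookup (\<kappa> S $ q) 0) \<noteq> 0" for q
  proof -
    obtain S where S: "S \<subseteq> {..<r}" "card S = 2" "c S * Poly_Mapping.lookup (\<kappa> S $ q) 0 \<noteq> 0"
      using sum.not_neutral_contains_not_neutral[OF ne] by blast
    then have "c S \<noteq> 0" "Poly_Mapping.lookup (\<kappa> S $ q) 0 \<noteq> 0" by auto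
    moreover have "homogeneous (int (\<Sum>i\<in>S. d i) - sh 2 ! q) (\<kappa> S $ q)"
      using comparison_at_vec[OF \<kappa> S(1)] S(2) q by (simp add: comparison_at_def)
    ultimately have "int (\<Sum>i\<in>S. d i) - sh 2 ! q = 0" "int (\<Sum>i\<in>S. d i) = t"
      using c by (auto simp: koszul2_fibre_piece_def dest!: homogeneous_lookup_zero)
    then show ?thesis by simp
  qed
  then show ?thesis by (auto simp: fibre_piece_def koszul2_fibre_map_def)
qed

text \<open>
  The comparison map commutes with the differentials on the element of \<open>K\<^sub>2\<close> represented by \<open>u\<close>. Its
  coefficient at a pair \<open>i < j\<close> is \<open>u (j, i) - u (i, j)\<close>, since the boundary of the
  basis element of \<open>{i, j}\<close> has \<open>F i\<close> at \<open>j\<close> and \<open>- F j\<close> at \<open>i\<close>.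
\<close>

lemma bd_koszul_combination:
  assumes \<kappa>: "koszul_comparison r d F sh \<phi> \<kappa>" and X: "X \<subseteq> {..<r}" and p: "p < rank 1"
  shows "bd 2 (\<lambda>l. \<Sum>S | S \<subseteq> X \<and> card S = 2.
      (u (Max S, Min S) - u (Min S, Max S)) * \<kappa> S $ l) p
    = (\<Sum>i\<in>X. koszul_boundary X F u i * \<kappa> {i} $ p)"
proof -
  have fin: "finite X" using X finite_subset by blast
  let ?f = "\<lambda>i j. (u (i, j) - u (j, i)) * F j * \<kappa> {i} $ p"
  have "(\<Sum>i\<in>X. koszul_boundary X F u i * \<kappa> {i} $ p) = (\<Sum>i\<in>X. \<Sum>j\<in>X. ?f i j)"
    by (simp add: koszul_boundary_def sum_distrib_right)
  also have "\<dots> = (\<Sum>S | S \<subseteq> X \<and> card S = 2. ?f (Min S) (Max S) + ?f (Max S) (Min S))"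
    by (rule sum_pairs[OF fin]) simp
  also have "\<dots> = (\<Sum>S | S \<subseteq> X \<and> card S = 2.
      (u (Max S, Min S) - u (Min S, Max S)) * bd 2 (\<lambda>l. \<kappa> S $ l) p)"
  proof (intro sum.cong refl)
    fix S assume "S \<in> {S. S \<subseteq> X \<and> card S = 2}"
    then obtain a b where ab: "S = {a, b}" "a \<noteq> b" and S: "S \<subseteq> X" by (auto simp: card_2_iff)
    then have S_eq: "S = {Min S, Max S}" and less: "Min S < Max S"
      by (auto simp: min_def max_def)
    have "Max S \<in> S" using ab by (intro Max_in) auto
    then have "Max S < r" using S X by auto
    from comparison_pair[OF \<kappa> less this p] S_eq
    have boundary: "bd 2 (\<lambda>l. \<kappa> S $ l) p = F (Min S) * \<kappa> {Max S} $ p - F (Max S) * \<kappa> {Min S} $ p" by simp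
    then show "?f (Min S) (Max S) + ?f (Max S) (Min S)
        = (u (Max S, Min S) - u (Min S, Max S)) * bd 2 (\<lambda>l. \<kappa> S $ l) p"
      unfolding boundary by (simp add: algebra_simps)
  qed
  finally show ?thesis by (simp add: bd_sum bd_scale)
qed

text \<open>
  Lift \<open>w\<close> to the element \<open>v\<close> of \<open>\<bbbF>\<^sub>2\<close> with constant entries. Its boundary \<open>z\<close> in \<open>\<bbbF>\<^sub>1\<close> is supported on the
  set \<open>Q\<close> of generators of degree less than \<open>t\<close>: for degree \<open>t\<close> an entry would be a constant, and it
  lies in the maximal ideal. Writing the generators in \<open>Q\<close> as combinations \<open>a\<close> of the forms turns \<open>z\<close>
  into a relation \<open>y\<close> of degree \<open>t\<close> among the \<open>F i\<close> with \<open>d i < t\<close>, which by assumption is the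
  boundary of an element \<open>u\<close> of \<open>K\<^sub>2\<close>. The image of \<open>u\<close> in \<open>\<bbbF>\<^sub>2\<close> differs from \<open>v\<close> by an
  element with zero constant coefficients, so the constant coefficients of \<open>u\<close> are mapped to \<open>w\<close>.
\<close>

lemma koszul_fibre_map_onto:
  assumes \<kappa>: "koszul_comparison r d F sh \<phi> \<kappa>"
    and ex: "koszul_exact {i. i < r \<and> d i < t} d t F"
    and w: "w \<in> fibre_piece (sh 2) (int t)"
  shows "\<exists>c\<in>koszul2_fibre_piece r d (int t). koszul2_fibre_map r (sh 2) \<kappa> c = w"
proof -
  define X where "X = {i. i < r \<and> d i < t}"
  have X: "X \<subseteq> {..<r}" "finite X" by (auto simp: X_def)
  define v :: "nat \<Rightarrow> ('v, 'k) mpoly" where "v l = Poly_Mapping.single 0 (w $ l)" for l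
  define z where "z = bd 2 v"
  define Q where "Q = {q. q < rank 1 \<and> sh 1 ! q < int t}"
  have finQ: "finite Q" by (simp add: Q_def)
  have z_hom: "homogeneous (int t - sh 1 ! q) (z q)" if "q < rank 1" for q
    unfolding z_def bd_def
  proof (rule homogeneous_sum)
    fix l assume l: "l \<in> {..<rank 2}"
    show "homogeneous (int t - sh 1 ! q) (\<phi> 2 $$ (q, l) * v l)"
    proof (cases "w $ l = 0")
      case False
      then have "sh 2 ! l = int t" using w l by (simp add: fibre_piece_def)
      moreover have "homogeneous (sh 2 ! l - sh 1 ! q + 0) (\<phi> 2 $$ (q, l) * v l)"
        unfolding v_def using entry_homogeneous[of 2 q l] l that
        by (intro homogeneous_mult homogeneous_const) auto
      ultimately show ?thesis by simp
    qed (simp add: v_def)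
  qed
  have z_const: "Poly_Mapping.lookup (z q) 0 = 0" if "q < rank 1" for q
    unfolding z_def using bd_minimal[of 2 q v] that by simp
  have z_zero: "z q = 0" if "q < rank 1" "q \<notin> Q" for q
  proof (cases "sh 1 ! q = int t")
    case True
    then show ?thesis using homogeneous_0_eq_0 z_hom[OF that(1)] z_const[OF that(1)] by simp
  next
    case False
    then show ?thesis using homogeneous_negative z_hom[OF that(1)] that by (force simp: Q_def)
  qed
  have "\<exists>a. a \<in> graded_piece {..<r} (\<lambda>i. int (d i)) (sh 1 ! q) \<and>
      relation_sum {..<r} F a = \<phi> 1 $$ (0, q)" if "q < rank 1" for q
    using generator_coefficients[OF that] by metis
  then obtain a where a: "\<And>q. q < rank 1 \<Longrightarrow>
        a q \<in> graded_piece {..<r} (\<lambda>i. int (d i)) (sh 1 ! q)"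
    "\<And>q. q < rank 1 \<Longrightarrow> relation_sum {..<r} F (a q) = \<phi> 1 $$ (0, q)"
    by metis
  have a_hom: "homogeneous (sh 1 ! q - int (d i)) (a q i)" if "q < rank 1" "i < r" for q i
    using a(1)[OF that(1)] that(2) by (simp add: graded_piece_def)
  have a_sum: "(\<Sum>i\<in>X. a q i * F i) = \<phi> 1 $$ (0, q)" if "q \<in> Q" for q
  proof -
    have q: "q < rank 1" "sh 1 ! q < int t" using that by (auto simp: Q_def)
    have "a q i = 0" if "i < r" "i \<notin> X" for i
      using homogeneous_negative[OF a_hom[OF q(1) that(1)]] q(2) that by (auto simp: X_def)
    then have "(\<Sum>i\<in>X. a q i * F i) = (\<Sum>i<r. a q i * F i)"
      using X by (intro sum.mono_neutral_left) auto
    then show ?thesis using a(2)[OF q(1)] by (simp add: relation_sum_def)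
  qed
  define y where "y i = (if i \<in> X then \<Sum>q\<in>Q. a q i * z q else 0)" for i
  have "y \<in> koszul1_piece X d t"
  proof -
    have "homogeneous (int t - int (d i)) (a q i * z q)" if "i \<in> X" "q \<in> Q" for i q
      using homogeneous_mult[OF a_hom[of q i] z_hom[of q]] that X by (auto simp: Q_def)
    then show ?thesis by (auto simp: graded_piece_def y_def intro: homogeneous_sum)
  qed
  moreover have "relation_sum X F y = 0"
  proof -
    have "relation_sum X F y = (\<Sum>i\<in>X. \<Sum>q\<in>Q. a q i * z q * F i)"
      by (simp add: relation_sum_def y_def sum_distrib_right)
    also have "\<dots> = (\<Sum>q\<in>Q. (\<Sum>i\<in>X. a q i * F i) * z q)"
      by (subst sum.swap) (simp add: sum_distrib_left mult_ac)
    also have "\<dots> = (\<Sum>q\<in>Q. \<phi> 1 $$ (0, q) * z q)" by (simp add: a_sum)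
    also have "\<dots> = bd 1 z 0"
      unfolding bd_def using z_zero by (intro sum.mono_neutral_left) (auto simp: Q_def)
    also have "\<dots> = 0" unfolding z_def using bd_bd[of 1 0 v] by (simp add: sh_0 numeral_2_eq_2)
    finally show ?thesis .
  qed
  ultimately obtain u where u: "u \<in> koszul2_piece X d t" "koszul_boundary X F u = y"
    using ex unfolding koszul_exact_def X_def by blast
  have "\<exists>x. \<forall>l<rank 1. (if l = q then 1 else 0) - (\<Sum>i\<in>X. a q i * \<kappa> {i} $ l) = bd 2 x l"
    if q: "q \<in> Q" for q
  proof -
    let ?e = "\<lambda>l. (if l = q then 1 else 0) - (\<Sum>i\<in>X. a q i * \<kappa> {i} $ l)"
    have q1: "q < rank 1" using q by (simp add: Q_def)
    have "bd 1 ?e 0 = \<phi> 1 $$ (0, q) - (\<Sum>i\<in>X. a q i * bd 1 (\<lambda>l. \<kappa> {i} $ l) 0)"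
      unfolding bd_diff bd_sum bd_scale bd_basis[OF q1] ..
    also have "(\<Sum>i\<in>X. a q i * bd 1 (\<lambda>l. \<kappa> {i} $ l) 0) = (\<Sum>i\<in>X. a q i * F i)"
      using X comparison_singleton(1)[OF \<kappa>] by (intro sum.cong) auto
    finally have "bd 1 ?e p = 0" if "p < rank (1 - 1)" for p
      using that a_sum[OF q] by (simp add: sh_0)
    from order_refl this show ?thesis
    proof (rule bd_exact)
      fix x assume "\<And>l. l < rank 1 \<Longrightarrow> ?e l = bd (1 + 1) x l"
      then show ?thesis unfolding one_add_one by (intro exI[of _ x] allI impI)
    qed
  qed
  \<comment> \<open>Going from a generator to the forms and back changes it by a boundary, here that of \<open>x q\<close>.\<close>
  then have "\<forall>q\<in>Q. \<exists>x. \<forall>l<rank 1.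
      (if l = q then 1 else 0) - (\<Sum>i\<in>X. a q i * \<kappa> {i} $ l) = bd 2 x l" by blast
  from bchoice[OF this] obtain x where "\<forall>q\<in>Q. \<forall>l<rank 1.
      (if l = q then 1 else 0) - (\<Sum>i\<in>X. a q i * \<kappa> {i} $ l) = bd 2 (x q) l" by (rule exE)
  then have x: "(if l = q then 1 else 0) - (\<Sum>i\<in>X. a q i * \<kappa> {i} $ l) = bd 2 (x q) l"
    if "q \<in> Q" "l < rank 1" for q l using that by blast
  let ?comb = "\<lambda>l. \<Sum>S | S \<subseteq> X \<and> card S = 2.
      (u (Max S, Min S) - u (Min S, Max S)) * \<kappa> S $ l"
  \<comment> \<open>A cycle, hence the image of an element of \<open>\<bbbF>\<^sub>3\<close>; together with the entries \<open>z q\<close>, which lie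
      in the maximal ideal, this makes \<open>v\<close> and the image of \<open>u\<close> agree in constant coefficients.\<close>
  define rem where "rem l = v l - ?comb l - (\<Sum>q\<in>Q. z q * x q l)" for l
  have "bd 2 rem p = 0" if p: "p < rank (2 - 1)" for p
  proof -
    have p1: "p < rank 1" using p by simp
    have "bd 2 rem p = z p - bd 2 ?comb p - (\<Sum>q\<in>Q. z q * bd 2 (x q) p)"
      unfolding rem_def bd_diff bd_sum bd_scale z_def ..
    also have "bd 2 ?comb p = (\<Sum>i\<in>X. y i * \<kappa> {i} $ p)"
      unfolding bd_koszul_combination[OF \<kappa> X(1) p1] u(2) ..
    also have "\<dots> = (\<Sum>i\<in>X. \<Sum>q\<in>Q. z q * (a q i * \<kappa> {i} $ p))"
      by (intro sum.cong refl) (simp add: y_def sum_distrib_left mult_ac)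
    also have "\<dots> = (\<Sum>q\<in>Q. z q * (\<Sum>i\<in>X. a q i * \<kappa> {i} $ p))"
      by (subst sum.swap) (simp add: sum_distrib_left)
    also have "(\<Sum>q\<in>Q. z q * bd 2 (x q) p)
        = (\<Sum>q\<in>Q. z q * ((if p = q then 1 else 0) - (\<Sum>i\<in>X. a q i * \<kappa> {i} $ p)))"
      by (intro sum.cong refl) (simp add: x[OF _ p1])
    also have "\<dots> = (\<Sum>q\<in>Q. z q * (if p = q then 1 else 0))
        - (\<Sum>q\<in>Q. z q * (\<Sum>i\<in>X. a q i * \<kappa> {i} $ p))"
      by (simp add: right_diff_distrib sum_subtractf)
    also have "(\<Sum>q\<in>Q. z q * (if p = q then 1 else 0)) = z p"
    proof -
      have "(\<Sum>q\<in>Q. z q * (if p = q then 1 else 0)) = (\<Sum>q\<in>Q. if p = q then z q else 0)"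
        by (intro sum.cong) auto
      also have "\<dots> = (if p \<in> Q then z p else 0)" using finQ by (rule sum.delta')
      finally show ?thesis using z_zero[OF p1] by auto
    qed
    finally show ?thesis by simp
  qed
  from bd_exact[OF _ this]
  obtain w' where w': "\<And>l. l < rank 2 \<Longrightarrow> rem l = bd 3 w' l" by auto
  define c where "c S = (if S \<subseteq> X \<and> card S = 2
    then Poly_Mapping.lookup (u (Max S, Min S) - u (Min S, Max S)) 0 else 0)" for S
  have w_eq: "w $ l = (\<Sum>S | S \<subseteq> {..<r} \<and> card S = 2. c S * Poly_Mapping.lookup (\<kappa> S $ l) 0)"
    if l: "l < rank 2" for l
  proof -
    have "Poly_Mapping.lookup (rem l) 0 = 0" using w'[OF l] bd_minimal[of 3 l w'] l by simp
    moreover have "Poly_Mapping.lookup (\<Sum>q\<in>Q. z q * x q l) 0 = 0"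
      using z_const by (simp add: lookup_sum lookup_mult_zero Q_def)
    moreover have "Poly_Mapping.lookup (v l) 0 = w $ l" by (simp add: v_def)
    ultimately have "w $ l = Poly_Mapping.lookup (?comb l) 0" by (simp add: rem_def lookup_minus)
    also have "\<dots> = (\<Sum>S | S \<subseteq> X \<and> card S = 2. c S * Poly_Mapping.lookup (\<kappa> S $ l) 0)"
      unfolding lookup_sum lookup_mult_zero by (intro sum.cong refl) (simp add: c_def)
    also have "\<dots> = (\<Sum>S | S \<subseteq> {..<r} \<and> card S = 2. c S * Poly_Mapping.lookup (\<kappa> S $ l) 0)"
      using X by (intro sum.mono_neutral_left) (auto simp: c_def)
    finally show ?thesis .
  qed
  have "c \<in> koszul2_fibre_piece r d (int t)"
    unfolding koszul2_fibre_piece_def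
  proof (intro CollectI allI impI)
    fix S assume "c S \<noteq> 0"
    then have S: "S \<subseteq> X" "card S = 2"
      and ne: "Poly_Mapping.lookup (u (Max S, Min S) - u (Min S, Max S)) 0 \<noteq> 0"
      by (auto simp: c_def split: if_splits)
    obtain i j where ij: "S = {i, j}" "i \<noteq> j" using S(2) by (auto simp: card_2_iff)
    have "Min S \<in> S" "Max S \<in> S" using ij by (auto intro: Min_in Max_in)
    moreover have "Min S \<noteq> Max S" using ij by (auto simp: min_def max_def)
    ultimately have S_eq: "S = {Min S, Max S}" "Min S \<in> X" "Max S \<in> X" using ij S(1) by auto
    then have "homogeneous (int t - (int (d (Min S)) + int (d (Max S))))
        (u (Max S, Min S) - u (Min S, Max S))"
      using u(1) by (auto simp: graded_piece_def add.commute intro!: homogeneous_diff)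
    from homogeneous_lookup_zero[OF this ne]
    have "int t = int (d (Min S)) + int (d (Max S))" by simp
    moreover have "(\<Sum>i\<in>S. d i) = d (Min S) + d (Max S)"
      using \<open>Min S \<noteq> Max S\<close> by (subst S_eq(1)) simp
    ultimately show "S \<subseteq> {..<r} \<and> card S = 2 \<and> int (\<Sum>i\<in>S. d i) = int t" using S X by auto
  qed
  moreover have "koszul2_fibre_map r (sh 2) \<kappa> c = w"
    using w w_eq by (intro eq_vecI) (auto simp: koszul2_fibre_map_def fibre_piece_def)
  ultimately show ?thesis by blast
qed

lemma ghost_term_comes_from_koszul:
  assumes "koszul_exact {i. i < r \<and> d i < t} d t F"
  shows "comes_from_koszul r d F sh \<phi> (int t)"
  unfolding comes_from_koszul_def
proof (intro conjI allI impI subset_antisym)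
  show "\<exists>\<kappa>. koszul_comparison r d F sh \<phi> \<kappa>" by (rule koszul_comparison_exists)
  fix \<kappa> assume \<kappa>: "koszul_comparison r d F sh \<phi> \<kappa>"
  show "koszul2_fibre_map r (sh 2) \<kappa> ` koszul2_fibre_piece r d (int t) \<subseteq> fibre_piece (sh 2) (int t)"
    using koszul_fibre_map_into[OF \<kappa>] by blast
  show "fibre_piece (sh 2) (int t) \<subseteq> koszul2_fibre_map r (sh 2) \<kappa> ` koszul2_fibre_piece r d (int t)"
    using koszul_fibre_map_onto[OF \<kappa> assms] by blast
qed

end

theorem proposition3p10:
  fixes r :: nat and d :: "nat \<Rightarrow> nat"
  assumes "infinite (UNIV :: 'k::field set)"
    and "CARD('v::finite) \<le> r"
    and "\<And>i. i < r \<Longrightarrow> 1 \<le> d i"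
    and "\<And>(s::nat) (e :: nat \<Rightarrow> nat). s < r \<Longrightarrow> (\<And>i. i < s \<Longrightarrow> 1 \<le> e i) \<Longrightarrow>
      for_general_forms s e
        (\<lambda>F :: nat \<Rightarrow> ('v, 'k) mpoly. maximal_rank_property (ideal_of s F))"
  shows "for_general_forms r d
    (\<lambda>F :: nat \<Rightarrow> ('v, 'k) mpoly.
       \<forall>sh \<phi> t. minimal_graded_free_resolution (ideal_of r F) sh \<phi> \<longrightarrow> ghost_term sh t \<longrightarrow>
         comes_from_koszul r d F sh \<phi> t)"
proof (rule for_general_forms_mono)
  show "for_general_forms r d (\<lambda>F :: nat \<Rightarrow> ('v, 'k) mpoly. \<forall>t\<in>d ` {..<r}.
      spans_degree {i. i < r \<and> d i < t} t F \<or> koszul_exact {i. i < r \<and> d i < t} d t F)"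
    by (intro for_general_forms_ball assms(1) finite_imageI finite_lessThan
        koszul_exact_or_spans_general[OF assms(1,3,4)])
next
  fix F :: "nat \<Rightarrow> ('v, 'k) mpoly"
  assume F: "F \<in> form_tuples r d"
    and general: "\<forall>t\<in>d ` {..<r}.
      spans_degree {i. i < r \<and> d i < t} t F \<or> koszul_exact {i. i < r \<and> d i < t} d t F"
  show "\<forall>sh \<phi> t. minimal_graded_free_resolution (ideal_of r F) sh \<phi> \<longrightarrow> ghost_term sh t \<longrightarrow>
      comes_from_koszul r d F sh \<phi> t"
  proof (intro allI impI)
    fix sh :: "nat \<Rightarrow> int list" and \<phi> :: "nat \<Rightarrow> ('v, 'k) mpoly mat" and t
    assume res: "minimal_graded_free_resolution (ideal_of r F) sh \<phi>" and ghost: "ghost_term sh t"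
    interpret resolution_of_forms r d F sh \<phi>
      by unfold_locales (use form_tuplesD[OF F] res in auto)
    obtain T where T: "t = int T" "T \<in> d ` {..<r}" "\<not> spans_degree {i. i < r \<and> d i < T} T F"
      using generator_degree ghost unfolding ghost_term_def by blast
    then have "koszul_exact {i. i < r \<and> d i < T} d T F" using general by blast
    then show "comes_from_koszul r d F sh \<phi> t" unfolding T(1) by (rule ghost_term_comes_from_koszul)
  qed
qed

end
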